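(* Let $k$ be a positive integer and let $G$ be a finite, simple, connected graph. Then $G$ contains, for every set $S$ of $k$ edges of $G$, a circuit whose edge set contains $S$ if and only if $G$ contains no odd cut of size at most $k$.
   Context: A walk in $G$ is a sequence of vertices $v_0v_1\dots v_r$ with consecutive vertices adjacent; a trail is a walk all of whose edges $v_{i-1}v_i$ are distinct; a circuit is a closed trail ($v_0=v_r$), which may repeat vertices but no edges. For $A\subseteq V(G)$, $\partial_G A=\{uv\in E(G): u\in A, v\notin A\}$. A set $F\subseteq E(G)$ is a cut of $G$ if $F=\partial_G A$ for some $A\subseteq V(G)$; a cut $F$ is odd if $|F|$ is odd.
   Formalization: The formal theorem additionally assumes that G has at least k edges; without this the statement fails, e.g. for G = K2 and k = 2, where no set of k edges exists but the single edge is an odd cut of size 1. *)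

theory Defs
  imports Main
begin

text \<open>A simple graph is given by a vertex set \<open>V\<close> and a set \<open>E\<close> of edges, each edge being an
  unordered pair \<open>{u, v}\<close> of distinct vertices.\<close>

definition finite_simple_graph :: "'a set \<Rightarrow> 'a set set \<Rightarrow> bool" where
  "finite_simple_graph V E \<longleftrightarrow>
     finite V \<and> (\<forall>e\<in>E. \<exists>u\<in>V. \<exists>v\<in>V. u \<noteq> v \<and> e = {u, v})"

fun walk_edges :: "'a list \<Rightarrow> 'a set list" where
  "walk_edges (x # y # zs) = {x, y} # walk_edges (y # zs)"
| "walk_edges _ = []"

definition walk :: "'a set \<Rightarrow> 'a set set \<Rightarrow> 'a list \<Rightarrow> bool" where
  "walk V E vs \<longleftrightarrow> vs \<noteq> [] \<and> set vs \<subseteq> V \<and> set (walk_edges vs) \<subseteq> E"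

definition trail :: "'a set \<Rightarrow> 'a set set \<Rightarrow> 'a list \<Rightarrow> bool" where
  "trail V E vs \<longleftrightarrow> walk V E vs \<and> distinct (walk_edges vs)"

definition circuit :: "'a set \<Rightarrow> 'a set set \<Rightarrow> 'a list \<Rightarrow> bool" where
  "circuit V E vs \<longleftrightarrow> trail V E vs \<and> hd vs = last vs"

definition connected_graph :: "'a set \<Rightarrow> 'a set set \<Rightarrow> bool" where
  "connected_graph V E \<longleftrightarrow>
     V \<noteq> {} \<and> (\<forall>u\<in>V. \<forall>v\<in>V. \<exists>vs. walk V E vs \<and> hd vs = u \<and> last vs = v)"

definition edge_boundary :: "'a set set \<Rightarrow> 'a set \<Rightarrow> 'a set set" where
  "edge_boundary E A = {e \<in> E. \<exists>u v. e = {u, v} \<and> u \<in> A \<and> v \<notin> A}"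

definition cut :: "'a set \<Rightarrow> 'a set set \<Rightarrow> 'a set set \<Rightarrow> bool" where
  "cut V E F \<longleftrightarrow> (\<exists>A. A \<subseteq> V \<and> F = edge_boundary E A)"

definition odd_cut :: "'a set \<Rightarrow> 'a set set \<Rightarrow> 'a set set \<Rightarrow> bool" where
  "odd_cut V E F \<longleftrightarrow> cut V E F \<and> odd (card F)"

end

theory Submission
  imports Defs
begin

text \<open>
  A circuit crosses every cut evenly, so an odd cut inside \<open>S\<close> cannot lie on a circuit. Conversely, a
  circuit is the same thing as an even, connected edge set, so we look for a set \<open>J\<close> of edges outside
  \<open>S\<close> that has the same parity as \<open>E\<close> on every cut and whose removal keeps the graph connected.

  If every cut has at least four edges, take by matroid intersection a largest forest \<open>I\<close> avoiding \<open>S\<close>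
  with \<open>E - I\<close> connected. If \<open>I\<close> spans, it contains a suitable \<open>J\<close>. Otherwise the
  min-max formula yields a set \<open>F\<close> of edges such that \<open>I \<inter> F\<close> spans \<open>F - S\<close> and few edges run between
  the components of \<open>F - S\<close>; as an odd component would send out more than \<open>k\<close> edges and odd
  components come in pairs, counting shows that all of them have even boundary, and \<open>J\<close> is found in \<open>I \<inter> F\<close>.

  A cut with two edges \<open>e\<close>, \<open>f\<close> is removed by contracting either side together with \<open>f\<close> and gluing
  the circuits of the two smaller multigraphs along \<open>e\<close>. For \<open>k \<ge> 3\<close> this leaves only cuts of
  size at least four; for \<open>k \<le> 2\<close> the graph is bridgeless and a circuit is extended edge by edge.
\<close>

section \<open>Cuts, connectivity and parity in multigraphs\<close>

text \<open>Contractions create parallel edges and loops, so edges are abstract objects with end vertices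
  \<open>h e\<close> and \<open>t e\<close> (in no particular order). Connectivity is expressed through cuts rather than walks.\<close>

definition bd :: "('e \<Rightarrow> 'v) \<Rightarrow> ('e \<Rightarrow> 'v) \<Rightarrow> 'v set \<Rightarrow> 'e set" where
  "bd h t A = {e. (h e \<in> A) \<noteq> (t e \<in> A)}"

definition conn :: "('e \<Rightarrow> 'v) \<Rightarrow> ('e \<Rightarrow> 'v) \<Rightarrow> 'e set \<Rightarrow> 'v \<Rightarrow> 'v \<Rightarrow> bool" where
  "conn h t N u v \<longleftrightarrow> (\<forall>A. N \<inter> bd h t A = {} \<longrightarrow> (u \<in> A \<longleftrightarrow> v \<in> A))"

text \<open>For finite \<open>H\<close> this amounts to even degree at every vertex, loops counted
  twice: modulo 2, the size of a cut is the sum of the degrees on one side.\<close>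

definition even_edges :: "('e \<Rightarrow> 'v) \<Rightarrow> ('e \<Rightarrow> 'v) \<Rightarrow> 'e set \<Rightarrow> bool" where
  "even_edges h t H \<longleftrightarrow> (\<forall>A. even (card (H \<inter> bd h t A)))"

text \<open>The edges of \<open>H\<close> form a single component, isolated vertices being ignored.
  Testing the ends \<open>h\<close> suffices, since an edge outside \<open>bd h t A\<close> has both
  ends on one side of \<open>A\<close>.\<close>

definition linked :: "('e \<Rightarrow> 'v) \<Rightarrow> ('e \<Rightarrow> 'v) \<Rightarrow> 'e set \<Rightarrow> bool" where
  "linked h t H \<longleftrightarrow> (\<forall>A. H \<inter> bd h t A = {} \<longrightarrow> h ` H \<subseteq> A \<or> h ` H \<inter> A = {})"

definition sdiff :: "'b set \<Rightarrow> 'b set \<Rightarrow> 'b set" where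
  "sdiff X Y = (X - Y) \<union> (Y - X)"

lemma mem_bd: "e \<in> bd h t A \<longleftrightarrow> (h e \<in> A) \<noteq> (t e \<in> A)"
  by (simp add: bd_def)

lemma mem_sdiff: "x \<in> sdiff X Y \<longleftrightarrow> (x \<in> X) \<noteq> (x \<in> Y)"
  by (auto simp: sdiff_def)

lemma bd_Compl: "bd h t (- A) = bd h t A"
  by (auto simp: bd_def)

lemma bd_sdiff: "bd h t (sdiff A B) = sdiff (bd h t A) (bd h t B)"
  by (auto simp: bd_def sdiff_def)

lemma odd_card_sdiff:
  assumes "finite X" "finite Y"
  shows "odd (card (sdiff X Y)) \<longleftrightarrow> odd (card X) \<noteq> odd (card Y)"
proof -
  have "card (sdiff X Y) = card (X - Y) + card (Y - X)"
    unfolding sdiff_def using assms by (intro card_Un_disjoint) auto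
  moreover have "card X = card (X - Y) + card (X \<inter> Y)" "card Y = card (Y - X) + card (X \<inter> Y)"
    using assms card_Int_Diff[of X Y] card_Int_Diff[of Y X] by (auto simp: Int_commute)
  ultimately show ?thesis by presburger
qed

text \<open>Cut parity is linear over GF(2), because taking boundaries commutes with symmetric
  differences. This is the additivity demanded of \<open>p\<close> in
  \<open>join_exists\<close>.\<close>

lemma odd_card_bd_sdiff:
  assumes "finite H"
  shows "odd (card (H \<inter> bd h t (sdiff A B))) \<longleftrightarrow>
    odd (card (H \<inter> bd h t A)) \<noteq> odd (card (H \<inter> bd h t B))"
proof -
  have "H \<inter> bd h t (sdiff A B) = sdiff (H \<inter> bd h t A) (H \<inter> bd h t B)"
    by (auto simp: mem_sdiff bd_sdiff)
  then show ?thesis using assms by (simp add: odd_card_sdiff)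
qed

lemma odd_card_Un:
  assumes "finite H" "finite K" "H \<inter> K = {}"
  shows "odd (card ((H \<union> K) \<inter> B)) \<longleftrightarrow> odd (card (H \<inter> B)) \<noteq> odd (card (K \<inter> B))"
proof -
  have "card ((H \<union> K) \<inter> B) = card (H \<inter> B) + card (K \<inter> B)"
    unfolding Int_Un_distrib2 using assms by (intro card_Un_disjoint) auto
  then show ?thesis by presburger
qed

lemma odd_card_Diff:
  assumes "finite H" "K \<subseteq> H"
  shows "odd (card ((H - K) \<inter> B)) \<longleftrightarrow> odd (card (H \<inter> B)) \<noteq> odd (card (K \<inter> B))"
proof -
  have "H - K \<union> K = H" "finite K" "finite (H - K)" using assms finite_subset by auto
  then show ?thesis using odd_card_Un[of "H - K" K B] by auto
qed

lemma odd_card_insert: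
  assumes "finite H" "e \<notin> H"
  shows "odd (card (insert e H \<inter> B)) \<longleftrightarrow> odd (card (H \<inter> B)) \<noteq> (e \<in> B)"
  using assms by (cases "e \<in> B") auto

text \<open>For \<open>p\<close> the parity of a vertex set \<open>T\<close> this is the existence of \<open>T\<close>-joins; the induction removes one
  edge of \<open>N\<close> and needs no paths.\<close>

lemma join_exists:
  assumes "finite N"
    and "\<And>A B. p (sdiff A B) \<longleftrightarrow> p A \<noteq> p B"
    and "\<And>A. N \<inter> bd h t A = {} \<Longrightarrow> \<not> p A"
  shows "\<exists>J\<subseteq>N. \<forall>A. odd (card (J \<inter> bd h t A)) \<longleftrightarrow> p A"
  using assms
proof (induction N arbitrary: p rule: finite_induct)
  case empty
  then show ?case by auto
next
  case (insert e N)
  show ?case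
  proof (cases "\<forall>A. N \<inter> bd h t A = {} \<longrightarrow> \<not> p A")
    case True
    with insert.IH[OF insert.prems(1)] obtain J
      where "J \<subseteq> N" "\<forall>A. odd (card (J \<inter> bd h t A)) \<longleftrightarrow> p A" by auto
    then show ?thesis by (intro exI[of _ J]) auto
  next
    case False
    \<comment> \<open>On \<open>A0\<close> the parity must be odd although \<open>e\<close> is the
      only available edge, so \<open>e\<close> has to belong to the join.\<close>
    then obtain A0 where A0: "N \<inter> bd h t A0 = {}" "p A0" by blast
    with insert.prems(2)[of A0] have eA0: "e \<in> bd h t A0" by auto
    \<comment> \<open>Adding \<open>e\<close> flips the parity of exactly the cuts containing
      \<open>e\<close>, so the remaining edges must realise \<open>q\<close>.\<close>
    define q where "q A \<longleftrightarrow> p A \<noteq> (e \<in> bd h t A)" for A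
    have q1: "q (sdiff A B) \<longleftrightarrow> q A \<noteq> q B" for A B
      unfolding q_def insert.prems(1) bd_sdiff mem_sdiff by argo
    have q2: "\<not> q A" if A: "N \<inter> bd h t A = {}" for A
    proof (cases "e \<in> bd h t A")
      case True
      \<comment> \<open>Since \<open>e\<close> crosses both \<open>A\<close> and \<open>A0\<close>,
        it does not cross their symmetric difference; additivity then forces \<open>p A\<close>,
        which makes \<open>q A\<close> false.\<close>
      have "insert e N \<inter> bd h t (sdiff A A0) = {}"
        using True eA0 A A0 by (auto simp: bd_sdiff mem_sdiff)
      then have "\<not> p (sdiff A A0)" by (rule insert.prems(2))
      then show ?thesis using True A0 insert.prems(1) by (simp add: q_def)
    next
      case False
      then show ?thesis using A insert.prems(2)[of A] by (auto simp: q_def)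
    qed
    from insert.IH[OF q1 q2] obtain J
      where J: "J \<subseteq> N" "\<And>A. odd (card (J \<inter> bd h t A)) \<longleftrightarrow> q A" by auto
    have "odd (card (insert e J \<inter> bd h t A)) \<longleftrightarrow> p A" for A
    proof -
      have "finite J" "e \<notin> J" using J(1) insert.hyps finite_subset by auto
      then show ?thesis by (simp add: odd_card_insert J(2) q_def del: Int_insert_left) blast
    qed
    then show ?thesis using J(1) by (intro exI[of _ "insert e J"]) blast
  qed
qed

section \<open>Connectivity and components\<close>

lemma conn_refl: "conn h t N u u" by (simp add: conn_def)
lemma conn_sym: "conn h t N u v \<Longrightarrow> conn h t N v u" by (simp add: conn_def)
lemma conn_trans: "conn h t N u v \<Longrightarrow> conn h t N v w \<Longrightarrow> conn h t N u w"
  by (simp add: conn_def)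
lemma conn_mono: "conn h t M u v \<Longrightarrow> M \<subseteq> N \<Longrightarrow> conn h t N u v"
  unfolding conn_def by blast
lemma conn_edge: "e \<in> N \<Longrightarrow> conn h t N (h e) (t e)"
  unfolding conn_def by (auto simp: bd_def)

definition component :: "('e \<Rightarrow> 'v) \<Rightarrow> ('e \<Rightarrow> 'v) \<Rightarrow> 'e set \<Rightarrow> 'v \<Rightarrow> 'v set" where
  "component h t N u = {v. conn h t N u v}"

lemma self_in_component: "u \<in> component h t N u"
  by (simp add: component_def conn_refl)

lemma component_closed: "N \<inter> bd h t (component h t N u) = {}"
proof -
  have "conn h t N u (h e) \<longleftrightarrow> conn h t N u (t e)" if "e \<in> N" for e
    using conn_edge[OF that, of h t] by (auto intro: conn_trans conn_sym)
  then show ?thesis by (auto simp: component_def mem_bd)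
qed

lemma component_eq_iff: "component h t N u = component h t N v \<longleftrightarrow> conn h t N u v"
  unfolding component_def using conn_refl conn_trans conn_sym by (metis (mono_tags) Collect_cong mem_Collect_eq)

lemma component_closed_iff: "e \<in> N \<Longrightarrow> h e \<in> component h t N u \<longleftrightarrow> t e \<in> component h t N u"
  using component_closed[of N h t u] by (auto simp: mem_bd)

lemma mem_component_iff: "v \<in> component h t N u \<longleftrightarrow> component h t N v = component h t N u"
  unfolding component_eq_iff by (auto simp: component_def intro: conn_sym)

lemma component_subset_closed:
  assumes "N \<inter> bd h t A = {}" "u \<in> A"
  shows "component h t N u \<subseteq> A"
  using assms unfolding component_def conn_def by blast

text \<open>The parity function of the vertex set \<open>{u, v}\<close>: its joins replace paths,
  though they may carry closed parts as well.\<close>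

lemma conn_join:
  assumes "finite N" "conn h t N u v"
  shows "\<exists>J\<subseteq>N. \<forall>A. odd (card (J \<inter> bd h t A)) \<longleftrightarrow> (u \<in> A) \<noteq> (v \<in> A)"
  using assms by (intro join_exists) (auto simp: mem_sdiff conn_def)

section \<open>Matroid intersection\<close>

text \<open>Matroid rank axioms on \<open>E\<close>, integer valued so that subtraction is harmless.
  A set \<open>X\<close> is independent when \<open>r X = int (card X)\<close>.\<close>

definition rank_fun :: "'e set \<Rightarrow> ('e set \<Rightarrow> int) \<Rightarrow> bool" where
  "rank_fun E r \<longleftrightarrow> r {} = 0 \<and>
     (\<forall>X e. X \<subseteq> E \<longrightarrow> e \<in> E \<longrightarrow> r X \<le> r (insert e X) \<and> r (insert e X) \<le> r X + 1) \<and>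
     (\<forall>X Y. X \<subseteq> E \<longrightarrow> Y \<subseteq> E \<longrightarrow> r (X \<union> Y) + r (X \<inter> Y) \<le> r X + r Y)"

lemma rank_fun_empty: "rank_fun E r \<Longrightarrow> r {} = 0"
  by (simp add: rank_fun_def)

lemma rank_fun_insert:
  assumes "rank_fun E r" "X \<subseteq> E" "e \<in> E"
  shows "r X \<le> r (insert e X)" "r (insert e X) \<le> r X + 1"
  using assms by (auto simp: rank_fun_def)

lemma rank_fun_submod:
  assumes "rank_fun E r" "X \<subseteq> E" "Y \<subseteq> E"
  shows "r (X \<union> Y) + r (X \<inter> Y) \<le> r X + r Y"
  using assms by (auto simp: rank_fun_def)

lemma rank_fun_subset:
  assumes r: "rank_fun E r" and "E' \<subseteq> E"
  shows "rank_fun E' r"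
proof -
  have "X \<subseteq> E" if "X \<subseteq> E'" for X using assms that by blast
  then show ?thesis
    using assms rank_fun_empty[OF r] rank_fun_insert[OF r] rank_fun_submod[OF r]
    unfolding rank_fun_def by (simp add: subset_iff)
qed

lemma rank_fun_Un:
  assumes r: "rank_fun E r" and "finite D" "X \<subseteq> E" "D \<subseteq> E"
  shows "r X \<le> r (X \<union> D) \<and> r (X \<union> D) \<le> r X + int (card D)"
  using assms(2-)
proof (induction D rule: finite_induct)
  case (insert e D)
  then have "r (X \<union> D) \<le> r (insert e (X \<union> D))" "r (insert e (X \<union> D)) \<le> r (X \<union> D) + 1"
    using rank_fun_insert[OF r, of "X \<union> D" e] by auto
  with insert show ?case by auto
qed simp

lemma rank_fun_mono:
  assumes "rank_fun E r" "finite E" "X \<subseteq> Y" "Y \<subseteq> E"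
  shows "r X \<le> r Y"
proof -
  have "finite (Y - X)" "X \<subseteq> E" "Y - X \<subseteq> E" using assms finite_subset by blast+
  then show ?thesis using rank_fun_Un[OF assms(1), of "Y - X" X] assms(3) by (simp add: Un_absorb1)
qed

lemma rank_fun_le_card:
  assumes "rank_fun E r" "finite E" "X \<subseteq> E"
  shows "r X \<le> int (card X)"
  using rank_fun_Un[OF assms(1), of X "{}"] assms finite_subset[of X E] rank_fun_empty[OF assms(1)] by auto

text \<open>Adding \<open>Y - X\<close> raises the rank by at most its size, so a deficit of
  \<open>X\<close> would persist in \<open>Y\<close>.\<close>

lemma rank_fun_indep_subset:
  assumes "rank_fun E r" "finite E" "X \<subseteq> Y" "Y \<subseteq> E" "r Y = int (card Y)"
  shows "r X = int (card X)"
proof -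
  have fY: "finite Y" using assms finite_subset by blast
  have "r Y \<le> r X + int (card (Y - X))"
    using rank_fun_Un[OF assms(1), of "Y - X" X] assms fY by (auto simp: Un_absorb1)
  moreover have "card Y = card X + card (Y - X)"
    using assms(3) fY by (metis card_Un_disjoint Diff_disjoint Un_Diff_cancel Un_absorb1 finite_Diff finite_subset)
  moreover have "r X \<le> int (card X)" using rank_fun_le_card assms by (meson order_trans)
  ultimately show ?thesis using assms(5) by linarith
qed

text \<open>Diminishing returns imply submodularity: add the elements of \<open>Y\<close> one by one
  to \<open>X\<close> and to \<open>X \<inter> Y\<close> and compare the gains.\<close>

lemma rank_funI:
  assumes E: "finite E" and "r {} = 0"
    and unit: "\<And>X e. X \<subseteq> E \<Longrightarrow> e \<in> E \<Longrightarrow> r X \<le> r (insert e X) \<and> r (insert e X) \<le> r X + (1::int)"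
    and dim: "\<And>X Y e. X \<subseteq> Y \<Longrightarrow> Y \<subseteq> E \<Longrightarrow> e \<in> E \<Longrightarrow> r (insert e Y) - r Y \<le> r (insert e X) - r X"
  shows "rank_fun E r"
proof -
  have "r (X \<union> Y) + r (X \<inter> Y) \<le> r X + r Y" if XY: "X \<subseteq> E" "Y \<subseteq> E" for X Y
  proof -
    have "r (X \<union> D) - r X \<le> r ((X \<inter> Y) \<union> D) - r (X \<inter> Y)" if "finite D" "D \<subseteq> E" for D
      using that
    proof (induction D rule: finite_induct)
      case (insert e D)
      then show ?case
        using dim[of "(X \<inter> Y) \<union> D" "X \<union> D" e] XY by (simp add: le_infI1)
    qed simp
    from this[of Y] have "r (X \<union> Y) - r X \<le> r ((X \<inter> Y) \<union> Y) - r (X \<inter> Y)"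
      using XY E finite_subset by blast
    moreover have "(X \<inter> Y) \<union> Y = Y" by blast
    ultimately show ?thesis by simp
  qed
  then show ?thesis using assms unfolding rank_fun_def by blast
qed

text \<open>The contraction by \<open>e\<close>; the assumption says that \<open>e\<close> is not a
  loop and makes the empty set have rank 0.\<close>

lemma rank_fun_contract:
  assumes r: "rank_fun (insert e E) r" and "r {e} = 1"
  shows "rank_fun E (\<lambda>X. r (insert e X) - 1)"
proof -
  have a: "r (insert e X) \<le> r (insert e (insert f X))" "r (insert e (insert f X)) \<le> r (insert e X) + 1"
    if "X \<subseteq> E" "f \<in> E" for X f
    using rank_fun_insert[OF r, of "insert e X" f] that by (auto simp: insert_commute)
  have b: "r (insert e (X \<union> Y)) + r (insert e (X \<inter> Y)) \<le> r (insert e X) + r (insert e Y)"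
    if "X \<subseteq> E" "Y \<subseteq> E" for X Y
    using rank_fun_submod[OF r, of "insert e X" "insert e Y"] that by auto
  show ?thesis unfolding rank_fun_def
  proof (intro conjI allI impI)
    show "r (insert e (insert f X)) - 1 \<le> r (insert e X) - 1 + 1" if "X \<subseteq> E" "f \<in> E" for X f
      using a(2)[OF that] by linarith
    show "r (insert e (X \<union> Y)) - 1 + (r (insert e (X \<inter> Y)) - 1) \<le> r (insert e X) - 1 + (r (insert e Y) - 1)"
      if "X \<subseteq> E" "Y \<subseteq> E" for X Y using b[OF that] by linarith
    show "r (insert e X) - 1 \<le> r (insert e (insert f X)) - 1" if "X \<subseteq> E" "f \<in> E" for X f
      using a(1)[OF that] by linarith
  qed (use assms(2) in auto)
qed

text \<open>Edmonds' theorem, the hard direction. Induction on the ground set: if the bound survives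
  the deletion of \<open>e\<close>, delete it; otherwise the bound survives its contraction, by
  uncrossing two violating sets.\<close>

theorem matroid_intersection:
  assumes "finite E" "rank_fun E r1" "rank_fun E r2"
    and "\<And>X. X \<subseteq> E \<Longrightarrow> int m \<le> r1 X + r2 (E - X)"
  shows "\<exists>I\<subseteq>E. card I = m \<and> r1 I = int m \<and> r2 I = int m"
  using assms
proof (induction E arbitrary: r1 r2 m rule: finite_induct)
  case empty
  then show ?case using rank_fun_empty[OF empty(1)] rank_fun_empty[OF empty(2)] empty(3)[of "{}"] by auto
next
  case (insert e E)
  note r1 = insert.prems(1) and r2 = insert.prems(2) and le = insert.prems(3)
  have sub: "rank_fun E r1" "rank_fun E r2" using r1 r2 rank_fun_subset by blast+
  show ?case
  proof (cases "\<forall>X\<subseteq>E. int m \<le> r1 X + r2 (E - X)")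
    case True
    then show ?thesis using insert.IH[OF sub, of m] by (meson subset_insertI2)
  next
    case False
    then obtain U where U: "U \<subseteq> E" "r1 U + r2 (E - U) < int m" by auto
    have compl: "insert e E - U = insert e (E - U)" "insert e E - insert e U = E - U"
      using U insert.hyps by auto
    \<comment> \<open>Moving \<open>e\<close> into either half of the violating partition restores
      the bound, so \<open>e\<close> has rank 1 in both matroids and may be contracted.\<close>
    have "r1 (insert e U) \<le> r1 U + r1 {e}"
    proof -
      have "(U) \<inter> {e} = {}" "(U) \<union> {e} = insert e (U)" "(U) \<subseteq> insert e E"
        using U insert.hyps by auto
      then show ?thesis using rank_fun_submod[OF r1, of "U" "{e}"] rank_fun_empty[OF r1] by simp
    qed
    moreover have "r1 {e} \<le> 1" using rank_fun_insert[OF r1, of "{}" e] rank_fun_empty[OF r1] by auto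
    ultimately have e1: "r1 {e} = 1"
      using U(2) le[of "insert e U"] compl U(1) by fastforce
    have "r2 (insert e (E - U)) \<le> r2 (E - U) + r2 {e}"
    proof -
      have "(E - U) \<inter> {e} = {}" "(E - U) \<union> {e} = insert e (E - U)" "(E - U) \<subseteq> insert e E"
        using U insert.hyps by auto
      then show ?thesis using rank_fun_submod[OF r2, of "E - U" "{e}"] rank_fun_empty[OF r2] by simp
    qed
    moreover have "r2 {e} \<le> 1" using rank_fun_insert[OF r2, of "{}" e] rank_fun_empty[OF r2] by auto
    ultimately have e2: "r2 {e} = 1"
      using U(2) le[of U] compl U(1) by fastforce
    have m: "m \<ge> 1"
    proof -
      have "r1 U \<ge> 0" "r2 (E - U) \<ge> 0"
        using rank_fun_mono[OF sub(1) insert.hyps(1), of "{}" U] rank_fun_empty[OF sub(1)]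
          rank_fun_mono[OF sub(2) insert.hyps(1), of "{}" "E - U"] rank_fun_empty[OF sub(2)] U by auto
      then show ?thesis using U by linarith
    qed
    \<comment> \<open>If the contraction failed at \<open>W\<close>, the ranks at \<open>U\<close>
      and \<open>W\<close> would total less than \<open>2 * m\<close>. Submodularity regroups them
      into the bounds at \<open>insert e (U \<union> W)\<close> and \<open>U \<inter> W\<close>,
      which total at least \<open>2 * m\<close>.\<close>
    have "int (m - 1) \<le> (r1 (insert e W) - 1) + (r2 (insert e (E - W)) - 1)" if W: "W \<subseteq> E" for W
    proof (rule ccontr)
      assume "\<not> ?thesis"
      then have "r1 (insert e W) + r2 (insert e (E - W)) \<le> int m" using m by linarith
      moreover have "r1 (insert e (U \<union> W)) + r1 (U \<inter> W) \<le> r1 U + r1 (insert e W)"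
      proof -
        have "U \<inter> insert e W = U \<inter> W" "U \<subseteq> insert e E" "W \<subseteq> insert e E"
          using U W insert.hyps by auto
        then show ?thesis using rank_fun_submod[OF r1, of U "insert e W"] by simp
      qed
      moreover have "r2 (insert e (E - (U \<inter> W))) + r2 (E - (U \<union> W)) \<le> r2 (E - U) + r2 (insert e (E - W))"
      proof -
        have "(E - U) \<union> insert e (E - W) = insert e (E - (U \<inter> W))"
          "(E - U) \<inter> insert e (E - W) = E - (U \<union> W)" using insert.hyps by auto
        then show ?thesis using rank_fun_submod[OF r2, of "E - U" "insert e (E - W)"] by auto
      qed
      moreover have "int m \<le> r1 (insert e (U \<union> W)) + r2 (E - (U \<union> W))"
      proof -
        have "insert e E - insert e (U \<union> W) = E - (U \<union> W)" using insert.hyps by auto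
        then show ?thesis using le[of "insert e (U \<union> W)"] U W by auto
      qed
      moreover have "int m \<le> r1 (U \<inter> W) + r2 (insert e (E - (U \<inter> W)))"
      proof -
        have "insert e E - (U \<inter> W) = insert e (E - (U \<inter> W))" using insert.hyps U by auto
        then show ?thesis using le[of "U \<inter> W"] U W by auto
      qed
      ultimately show False using U(2) by linarith
    qed
    from insert.IH[OF rank_fun_contract[OF r1 e1] rank_fun_contract[OF r2 e2] this]
    obtain I where I: "I \<subseteq> E" "card I = m - 1" "r1 (insert e I) - 1 = int (m - 1)"
      "r2 (insert e I) - 1 = int (m - 1)" by blast
    have "finite I" "e \<notin> I" using I(1) insert.hyps finite_subset by auto
    then show ?thesis using I m by (intro exI[of _ "insert e I"]) auto
  qed
qed

section \<open>Duals and deletions of matroids\<close>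

lemma rank_fun_diminish:
  assumes r: "rank_fun E r" and "X \<subseteq> Y" "Y \<subseteq> E" "e \<in> E"
  shows "r (insert e Y) - r Y \<le> r (insert e X) - r X"
proof (cases "e \<in> Y")
  case True
  then show ?thesis using rank_fun_insert(1)[OF r, of X e] assms by (auto simp: insert_absorb)
next
  case False
  then have "insert e X \<union> Y = insert e Y" "insert e X \<inter> Y = X" using assms by auto
  moreover have "insert e X \<subseteq> E" using assms by blast
  ultimately show ?thesis using rank_fun_submod[OF r, of "insert e X" Y] assms(3) by simp
qed

text \<open>The dual matroid: \<open>X\<close> is independent in it exactly when deleting
  \<open>X\<close> keeps the rank of \<open>E\<close>, so in a graph when the deletion disconnects
  nothing.\<close>

lemma rank_fun_dual:
  assumes r: "rank_fun E r" and E: "finite E"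
  shows "rank_fun E (\<lambda>X. int (card X) - r E + r (E - X))"
proof (rule rank_funI[OF E])
  have ins: "int (card (insert e X)) = int (card X) + 1" "E - X = insert e (E - insert e X)"
    if "X \<subseteq> E" "e \<in> E" "e \<notin> X" for X e
    using that finite_subset[OF that(1) E] by auto
  show unit: "int (card X) - r E + r (E - X) \<le> int (card (insert e X)) - r E + r (E - insert e X) \<and>
      int (card (insert e X)) - r E + r (E - insert e X) \<le> int (card X) - r E + r (E - X) + 1"
    if "X \<subseteq> E" "e \<in> E" for X e
  proof (cases "e \<in> X")
    case False
    then show ?thesis
      using ins[OF that False] rank_fun_insert[OF r, of "E - insert e X" e] that(2) by auto
  qed (simp add: insert_absorb)
  show "int (card (insert e Y)) - r E + r (E - insert e Y) - (int (card Y) - r E + r (E - Y))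
      \<le> int (card (insert e X)) - r E + r (E - insert e X) - (int (card X) - r E + r (E - X))"
    if "X \<subseteq> Y" "Y \<subseteq> E" "e \<in> E" for X Y e
  proof (cases "e \<in> Y")
    case True
    have "X \<subseteq> E" using that by blast
    then show ?thesis using unit[of X e] that True by (simp add: insert_absorb)
  next
    case False
    have XE: "X \<subseteq> E" "e \<notin> X" using that False by auto
    have "r (insert e (E - insert e X)) - r (E - insert e X) \<le> r (insert e (E - insert e Y)) - r (E - insert e Y)"
      using that by (intro rank_fun_diminish[OF r]) auto
    then have "r (E - X) - r (E - insert e X) \<le> r (E - Y) - r (E - insert e Y)"
      using ins(2)[OF XE(1) that(3) XE(2)] ins(2)[OF that(2,3) False] by simp
    then show ?thesis using ins(1)[OF XE(1) that(3) XE(2)] ins(1)[OF that(2,3) False] by simp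
  qed
qed simp

text \<open>The elements of \<open>S\<close> become loops, so that independent sets avoid
  \<open>S\<close> while the ground set stays \<open>E\<close>.\<close>

lemma rank_fun_delete:
  assumes r: "rank_fun E r"
  shows "rank_fun E (\<lambda>X. r (X - S))"
  unfolding rank_fun_def
proof (intro conjI allI impI)
  show "r ({} - S) = 0" using rank_fun_empty[OF r] by simp
  show "r (X - S) \<le> r (insert e X - S)" "r (insert e X - S) \<le> r (X - S) + 1"
    if "X \<subseteq> E" "e \<in> E" for X e
    using rank_fun_insert[OF r, of "X - S" e] that by (auto simp: insert_Diff_if)
  show "r (X \<union> Y - S) + r (X \<inter> Y - S) \<le> r (X - S) + r (Y - S)" if "X \<subseteq> E" "Y \<subseteq> E" for X Y
  proof -
    have "X \<union> Y - S = (X - S) \<union> (Y - S)" "X \<inter> Y - S = (X - S) \<inter> (Y - S)" by auto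
    then show ?thesis using rank_fun_submod[OF r, of "X - S" "Y - S"] that by auto
  qed
qed

section \<open>The graphic rank function\<close>

definition parts :: "('e \<Rightarrow> 'v) \<Rightarrow> ('e \<Rightarrow> 'v) \<Rightarrow> 'v set \<Rightarrow> 'e set \<Rightarrow> 'v set set" where
  "parts h t V F = component h t F ` V"

text \<open>The union of the components of the two ends is closed under \<open>insert e F\<close>,
  and every other component stays closed because it contains neither end.\<close>

lemma component_insert:
  "component h t (insert e F) w =
    (if w \<in> component h t F (h e) \<union> component h t F (t e)
     then component h t F (h e) \<union> component h t F (t e) else component h t F w)"
proof -
  let ?C = "component h t F (h e) \<union> component h t F (t e)"
  have up: "component h t F u \<subseteq> component h t (insert e F) u" for u
    unfolding component_def using conn_mono[of h t F u _ "insert e F"] by auto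
  have Ccl: "insert e F \<inter> bd h t ?C = {}"
    using self_in_component[of "h e" h t F] self_in_component[of "t e" h t F]
    by (auto simp: mem_bd dest: component_closed_iff[of _ F h t])
  have he: "component h t (insert e F) (h e) = component h t (insert e F) (t e)"
    by (simp add: component_eq_iff conn_edge)
  show ?thesis
  proof (cases "w \<in> ?C")
    case True
    have "component h t (insert e F) w \<subseteq> ?C" by (rule component_subset_closed[OF Ccl True])
    moreover have "w \<in> component h t (insert e F) (h e)"
      using True up[of "h e"] up[of "t e"] he by auto
    then have "component h t (insert e F) w = component h t (insert e F) (h e)"
      unfolding mem_component_iff .
    then have "?C \<subseteq> component h t (insert e F) w" using up[of "h e"] up[of "t e"] he by auto
    ultimately show ?thesis using True by auto
  next
    case False
    have dis: "component h t F w \<inter> ?C = {}"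
      using False by (auto simp: mem_component_iff)
    have "insert e F \<inter> bd h t (component h t F w) = {}"
      using dis self_in_component[of "h e" h t F] self_in_component[of "t e" h t F]
      by (auto simp: mem_bd dest: component_closed_iff[of _ F h t])
    then have "component h t (insert e F) w \<subseteq> component h t F w"
      using component_subset_closed self_in_component by metis
    then show ?thesis using up[of w] False by auto
  qed
qed

lemma card_parts_insert:
  assumes V: "finite V" and e: "h e \<in> V" "t e \<in> V"
  shows "int (card (parts h t V (insert e F))) =
    int (card (parts h t V F)) - (if conn h t F (h e) (t e) then 0 else 1)"
proof -
  let ?A = "component h t F (h e)" and ?B = "component h t F (t e)"
  have fin: "finite (parts h t V F)" using V by (simp add: parts_def)
  note memA = mem_component_iff[of _ h t F "h e"] mem_component_iff[of _ h t F "t e"]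
  show ?thesis
  proof (cases "conn h t F (h e) (t e)")
    case True
    then have AB: "?A = ?B" by (simp add: component_eq_iff)
    have "component h t (insert e F) w = component h t F w" for w
      unfolding component_insert using memA[of w] AB by auto
    then show ?thesis using True by (simp add: parts_def)
  next
    case False
    then have AB: "?A \<noteq> ?B" by (simp add: component_eq_iff)
    have eq: "component h t (insert e F) w =
        (if component h t F w \<in> {?A, ?B} then ?A \<union> ?B else component h t F w)" for w
      unfolding component_insert using memA[of w] by auto
    have "parts h t V (insert e F) = insert (?A \<union> ?B) (parts h t V F - {?A, ?B})"
      unfolding parts_def eq using e by (auto split: if_splits)
    \<comment> \<open>The merged set is new: it contains \<open>h e\<close>, so as an old part it
      could only be \<open>?A\<close>, which has been removed.\<close>
    moreover have "?A \<union> ?B \<notin> parts h t V F - {?A, ?B}"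
    proof
      assume "?A \<union> ?B \<in> parts h t V F - {?A, ?B}"
      then obtain w where w: "?A \<union> ?B = component h t F w" "component h t F w \<noteq> ?A"
        by (auto simp: parts_def)
      have "h e \<in> component h t F w" using w(1) self_in_component[of "h e" h t F] by auto
      then have "component h t F w = ?A" by (simp add: mem_component_iff)
      then show False using w by simp
    qed
    moreover have "card (parts h t V F - {?A, ?B}) = card (parts h t V F) - 2"
      using AB e fin by (subst card_Diff_subset) (auto simp: parts_def)
    moreover have "card (parts h t V F) \<ge> 2"
    proof -
      have "{?A, ?B} \<subseteq> parts h t V F" using e by (auto simp: parts_def)
      then have "card {?A, ?B} \<le> card (parts h t V F)" using fin card_mono by blast
      then show ?thesis using AB by simp
    qed
    ultimately show ?thesis using False fin by simp
  qed
qed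

text \<open>The rank in the cycle matroid: the size of a spanning forest of \<open>F\<close>.
  Isolated vertices of \<open>V\<close> count as parts.\<close>

definition grank :: "('e \<Rightarrow> 'v) \<Rightarrow> ('e \<Rightarrow> 'v) \<Rightarrow> 'v set \<Rightarrow> 'e set \<Rightarrow> int" where
  "grank h t V F = int (card V) - int (card (parts h t V F))"

lemma grank_insert:
  assumes "finite V" "h e \<in> V" "t e \<in> V"
  shows "grank h t V (insert e F) = grank h t V F + (if conn h t F (h e) (t e) then 0 else 1)"
  using card_parts_insert[of V h e t F] assms by (simp add: grank_def)

text \<open>An edge gains rank only if its ends are not yet connected, and connections persist in
  larger edge sets; hence diminishing returns.\<close>

lemma rank_fun_grank:
  assumes V: "finite V" and E: "finite E" and ends: "h ` E \<union> t ` E \<subseteq> V"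
  shows "rank_fun E (grank h t V)"
proof (rule rank_funI[OF E])
  have "component h t {} u = {u}" for u
    unfolding component_def conn_def by auto
  then show "grank h t V {} = 0" by (simp add: grank_def parts_def card_image)
  have e: "h e \<in> V" "t e \<in> V" if "e \<in> E" for e using ends that by auto
  show "grank h t V X \<le> grank h t V (insert e X) \<and> grank h t V (insert e X) \<le> grank h t V X + 1"
    if "e \<in> E" for X e using e[OF that] V by (simp add: grank_insert)
  show "grank h t V (insert e Y) - grank h t V Y \<le> grank h t V (insert e X) - grank h t V X"
    if "X \<subseteq> Y" "e \<in> E" for X Y e
    using e[OF that(2)] V conn_mono[OF _ that(1), of h t] by (auto simp: grank_insert)
qed

text \<open>If \<open>M\<close> has the rank of \<open>N\<close>, it spans \<open>N\<close>: an edge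
  of \<open>N\<close> with ends not connected by \<open>M\<close> would raise the rank of
  \<open>M\<close> above that of \<open>N\<close>.\<close>

lemma grank_le_conn:
  assumes V: "finite V" and E: "finite E" and ends: "h ` E \<union> t ` E \<subseteq> V"
    and sub: "M \<subseteq> N" "N \<subseteq> E" and le: "grank h t V N \<le> grank h t V M" and e: "e \<in> N"
  shows "conn h t M (h e) (t e)"
proof (rule ccontr)
  assume "\<not> ?thesis"
  moreover have "h e \<in> V" "t e \<in> V" using e sub ends by blast+
  ultimately have "grank h t V (insert e M) = grank h t V M + 1"
    using V \<open>h e \<in> V\<close> \<open>t e \<in> V\<close> by (subst grank_insert) auto
  moreover have "grank h t V (insert e M) \<le> grank h t V N"
    using rank_fun_mono[OF rank_fun_grank[OF V E ends] E, where X = "insert e M" and Y = N] e sub by auto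
  ultimately show False using le by linarith
qed

section \<open>Graphs without cuts of size at most three\<close>

text \<open>A disjoint union is an iterated symmetric difference, so the parity of its boundary is
  the sum of the parities of the members.\<close>

lemma odd_bd_Union:
  assumes E: "finite E" and "finite W" "pairwise disjnt W" "odd (card (E \<inter> bd h t (\<Union>W)))"
  shows "\<exists>Q\<in>W. odd (card (E \<inter> bd h t Q))"
  using assms(2-)
proof (induction W rule: finite_induct)
  case empty
  then show ?case by (simp add: bd_def)
next
  case (insert Q W)
  have "Q \<inter> \<Union>W = {}"
    using insert.prems(1) insert.hyps(2) by (auto simp: pairwise_insert disjnt_def)
  then have "\<Union>(insert Q W) = sdiff Q (\<Union>W)" by (auto simp: sdiff_def)
  then have "odd (card (E \<inter> bd h t Q)) \<or> odd (card (E \<inter> bd h t (\<Union>W)))"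
    using insert.prems(2) odd_card_bd_sdiff[OF E, of h t Q "\<Union>W"] by metis
  then show ?case using insert by (auto simp: pairwise_insert)
qed

lemma pairwise_disjnt_parts: "pairwise disjnt (parts h t V F)"
  unfolding pairwise_def disjnt_def parts_def by (force simp: mem_component_iff)

text \<open>Double counting: an edge lies only in the boundaries of the parts of its two ends, and
  in none if these parts coincide.\<close>

lemma sum_bd_parts_le:
  assumes E: "finite E" and V: "finite V"
  shows "(\<Sum>Q\<in>parts h t V F. card (E \<inter> bd h t Q)) \<le> 2 * card {e \<in> E. \<not> conn h t F (h e) (t e)}"
proof -
  let ?P = "parts h t V F"
  have P: "finite ?P" using V by (simp add: parts_def)
  have "(\<Sum>Q\<in>?P. card (E \<inter> bd h t Q)) = (\<Sum>Q\<in>?P. \<Sum>e\<in>E. if e \<in> bd h t Q then 1 else 0)"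
    using E by (simp add: sum.If_cases)
  also have "\<dots> = (\<Sum>e\<in>E. card {Q \<in> ?P. e \<in> bd h t Q})"
    using P by (subst sum.swap) (simp add: sum.If_cases Int_def)
  also have "\<dots> \<le> (\<Sum>e\<in>E. if \<not> conn h t F (h e) (t e) then 2 else 0)"
  proof (rule sum_mono)
    fix e assume "e \<in> E"
    have Q: "Q = component h t F (h e) \<or> Q = component h t F (t e)"
      "\<not> conn h t F (h e) (t e)" if Q: "Q \<in> ?P" "e \<in> bd h t Q" for Q
      using Q by (auto simp: parts_def mem_bd mem_component_iff component_eq_iff[symmetric])
    show "card {Q \<in> ?P. e \<in> bd h t Q} \<le> (if \<not> conn h t F (h e) (t e) then 2 else 0)"
    proof (cases "conn h t F (h e) (t e)")
      case True
      then have "{Q \<in> ?P. e \<in> bd h t Q} = {}" using Q(2) by blast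
      then show ?thesis by (metis card.empty zero_le)
    next
      case False
      have "{Q \<in> ?P. e \<in> bd h t Q} \<subseteq> {component h t F (h e), component h t F (t e)}" using Q(1) by blast
      then have "card {Q \<in> ?P. e \<in> bd h t Q} \<le> card {component h t F (h e), component h t F (t e)}"
        by (intro card_mono) auto
      also have "\<dots> \<le> 2" by (simp add: card_insert_if)
      finally show ?thesis using False by simp
    qed
  qed
  also have "\<dots> = 2 * card {e \<in> E. \<not> conn h t F (h e) (t e)}"
    using E by (simp add: sum.If_cases Int_def)
  finally show ?thesis .
qed

lemma four_edge_connected_case:
  fixes h t :: "'e \<Rightarrow> 'v"
  assumes V: "finite V" "V \<noteq> {}" and E: "finite E" and im: "h ` E \<union> t ` E \<subseteq> V"
    and S: "S \<subseteq> E" "card S \<le> k"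
    and four: "\<And>A. A \<inter> V \<noteq> {} \<Longrightarrow> \<not> V \<subseteq> A \<Longrightarrow> 4 \<le> card (E \<inter> bd h t A)"
    and odd: "\<And>A. odd (card (E \<inter> bd h t A)) \<Longrightarrow> k < card (E \<inter> bd h t A)"
    and k: "1 \<le> k"
  shows "\<exists>H\<subseteq>E. S \<subseteq> H \<and> even_edges h t H \<and> linked h t H"
proof -
  have ends: "h e \<in> V \<and> t e \<in> V" if "e \<in> E" for e using im that by blast
  let ?r = "grank h t V"
  define r1 where "r1 X = int (card X) - ?r E + ?r (E - X)" for X
  define r2 where "r2 X = ?r (X - S)" for X
  have R: "rank_fun E ?r" by (rule rank_fun_grank[OF V(1) E im])
  have R1: "rank_fun E r1" using rank_fun_dual[OF R E] by (simp add: r1_def[abs_def])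
  have R2: "rank_fun E r2" using rank_fun_delete[OF R] by (simp add: r2_def[abs_def])
  \<comment> \<open>\<open>X\<close> attains the minimum in the min-max formula; the independent set
    \<open>I\<close> obtained below has exactly this size.\<close>
  define X where "X = arg_min_on (\<lambda>X. r1 X + r2 (E - X)) (Pow E)"
  have XE: "X \<subseteq> E"
    using arg_min_if_finite(1)[of "Pow E" "\<lambda>X. r1 X + r2 (E - X)"] E by (auto simp: X_def)
  have Xmin: "r1 X + r2 (E - X) \<le> r1 Y + r2 (E - Y)" if "Y \<subseteq> E" for Y
    using arg_min_least[of "Pow E" Y "\<lambda>X. r1 X + r2 (E - X)"] E that by (auto simp: X_def)
  define F where "F = E - X"
  have FE: "F \<subseteq> E" "E - F = X" using XE by (auto simp: F_def)
  have "0 \<le> r1 X" "0 \<le> r2 (E - X)"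
    using rank_fun_mono[OF R1 E, of "{}" X] rank_fun_mono[OF R2 E, of "{}" "E - X"]
      rank_fun_empty[OF R1] rank_fun_empty[OF R2] XE by auto
  then have nn: "int (nat (r1 X + r2 (E - X))) = r1 X + r2 (E - X)" by simp
  obtain I where IE: "I \<subseteq> E" and I: "int (card I) = r1 X + r2 F" "r1 I = int (card I)" "r2 I = int (card I)"
    using matroid_intersection[OF E R1 R2, of "nat (r1 X + r2 (E - X))"] Xmin nn F_def by auto
  have fI: "finite I" using IE E finite_subset by blast
  have IS: "I \<inter> S = {}"
  proof (rule ccontr)
    assume "I \<inter> S \<noteq> {}"
    then have "card (I - S) < card I" using fI by (intro psubset_card_mono) auto
    moreover have "r2 I \<le> int (card (I - S))"
      unfolding r2_def using IE by (intro rank_fun_le_card[OF R E]) auto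
    ultimately show False using I(3) by simp
  qed
  then have "I - S = I" by blast
  then have rI: "?r I = int (card I)" using I(3) by (simp add: r2_def)
  have rEI: "?r (E - I) = ?r E" using I(2) by (simp add: r1_def)

  \<comment> \<open>Dual independence of \<open>I\<close> means that \<open>E - I\<close> has full
    rank, so a cut missed by \<open>E - I\<close> has no edges at all.\<close>
  have full: "E \<inter> bd h t A = {}" if "(E - I) \<inter> bd h t A = {}" for A
  proof -
    have "conn h t (E - I) (h e) (t e)" if "e \<in> E" for e
      using grank_le_conn[OF V(1) E im, where M = "E - I" and N = E and e = e] rEI that by auto
    then show ?thesis using that by (fastforce simp: conn_def mem_bd)
  qed
  have outside: "E \<inter> bd h t A = {}" if "A \<inter> V = {} \<or> V \<subseteq> A" for A
    using that ends by (fastforce simp: mem_bd)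

  \<comment> \<open>A join \<open>J\<close> inside \<open>N\<close> with the cut parities of
    \<open>E\<close> leaves \<open>E - J\<close> even. It contains \<open>S\<close> because
    \<open>I\<close> avoids \<open>S\<close>, and it is linked because it contains
    \<open>E - I\<close>.\<close>
  have suff: ?thesis if N: "N \<subseteq> I" "\<And>A. N \<inter> bd h t A = {} \<Longrightarrow> even (card (E \<inter> bd h t A))" for N
  proof -
    have fN: "finite N" using N fI finite_subset by blast
    obtain J where J: "J \<subseteq> N" "\<And>A. odd (card (J \<inter> bd h t A)) \<longleftrightarrow> odd (card (E \<inter> bd h t A))"
      using join_exists[OF fN, of "\<lambda>A. odd (card (E \<inter> bd h t A))" h t] odd_card_bd_sdiff[OF E, of h t] N(2) by auto
    have JE: "J \<subseteq> E" using J N IE by blast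
    have "even_edges h t (E - J)"
      unfolding even_edges_def using odd_card_Diff[OF E JE] J(2) by blast
    moreover have "linked h t (E - J)"
      unfolding linked_def
    proof (intro allI impI)
      fix A assume A: "(E - J) \<inter> bd h t A = {}"
      then have "E \<inter> bd h t A = {}" using full J N by blast
      then have "A \<inter> V = {} \<or> V \<subseteq> A" using four[of A] by fastforce
      then show "h ` (E - J) \<subseteq> A \<or> h ` (E - J) \<inter> A = {}" using ends by blast
    qed
    moreover have "S \<subseteq> E - J" using S IS J N by blast
    ultimately show ?thesis by (intro exI[of _ "E - J"]) blast
  qed

  have parts_fin: "finite (parts h t V N)" for N using V by (simp add: parts_def)
  have part_sub: "component h t N u \<subseteq> V" if "u \<in> V" "N \<subseteq> E" for N u
    by (rule component_subset_closed) (use that ends in \<open>auto simp: mem_bd\<close>)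

  show ?thesis
  proof (cases "card (parts h t V I) \<le> 1")
    case True
    \<comment> \<open>Here \<open>I\<close> connects all of \<open>V\<close>, so a cut missed by
      \<open>I\<close> does not separate \<open>V\<close> and is empty.\<close>
    have "even (card (E \<inter> bd h t A))" if A: "I \<inter> bd h t A = {}" for A
    proof (rule ccontr)
      assume "odd (card (E \<inter> bd h t A))"
      then have "A \<inter> V \<noteq> {}" "\<not> V \<subseteq> A" using outside[of A] by fastforce+
      then obtain u v where uv: "u \<in> V" "u \<in> A" "v \<in> V" "v \<notin> A" by blast
      then have "component h t I u \<subseteq> A" using A by (intro component_subset_closed) auto
      then have "component h t I u \<noteq> component h t I v" using uv self_in_component by fast
      moreover have "{component h t I u, component h t I v} \<subseteq> parts h t V I" using uv by (auto simp: parts_def)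
      ultimately have "2 \<le> card (parts h t V I)"
        using card_mono[OF parts_fin] by (metis card_2_iff)
      then show False using True by simp
    qed
    then show ?thesis by (intro suff[of I]) auto
  next
    case False
    let ?N = "I \<inter> F" and ?P = "parts h t V (F - S)"
    \<comment> \<open>Equality in the min-max formula leaves at least \<open>r2 F\<close> elements
      of \<open>I\<close> in \<open>F\<close>; being independent, \<open>I \<inter> F\<close> is a
      spanning forest of \<open>F - S\<close>.\<close>
    have "int (card (I \<inter> X)) \<le> r1 X"
      using rank_fun_indep_subset[OF R1 E _ IE I(2), of "I \<inter> X"] rank_fun_mono[OF R1 E, of "I \<inter> X" X] XE by auto
    moreover have "card I = card (I \<inter> X) + card (I \<inter> F)"
    proof -
      have "I - X = I \<inter> F" using IE by (auto simp: F_def)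
      then show ?thesis using card_Int_Diff[OF fI, of X] by simp
    qed
    ultimately have "?r (F - S) \<le> int (card ?N)" using I(1) by (simp add: r2_def)
    also have "int (card ?N) = ?r ?N"
      using rank_fun_indep_subset[OF R E _ IE rI, of ?N] by auto
    finally have span: "conn h t ?N (h e) (t e)" if "e \<in> F - S" for e
      using grank_le_conn[OF V(1) E im, where M = ?N and N = "F - S" and e = e] that IS FE by auto
    have "even (card (E \<inter> bd h t A))" if A: "?N \<inter> bd h t A = {}" for A
    proof (rule ccontr)
      assume oddA: "odd (card (E \<inter> bd h t A))"
      have clA: "(F - S) \<inter> bd h t A = {}"
      proof -
        have "e \<notin> bd h t A" if "e \<in> F - S" for e
          using span[OF that] A unfolding conn_def mem_bd by blast
        then show ?thesis by blast
      qed
      \<comment> \<open>A set closed under \<open>F - S\<close> is, within \<open>V\<close>, a union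
        of parts, so an odd boundary is inherited by one part inside it. Applied to \<open>A\<close>
        and to its complement this gives two different odd parts.\<close>
      have find: "\<exists>Q\<in>?P. Q \<subseteq> B \<and> odd (card (E \<inter> bd h t Q))"
        if B: "(F - S) \<inter> bd h t B = {}" "odd (card (E \<inter> bd h t B))" for B
      proof -
        let ?W = "{Q \<in> ?P. Q \<subseteq> B}"
        have "\<Union>?W = B \<inter> V"
        proof
          show "\<Union>?W \<subseteq> B \<inter> V" using part_sub[of _ "F - S"] FE(1) unfolding parts_def by blast
          show "B \<inter> V \<subseteq> \<Union>?W"
          proof
            fix u assume u: "u \<in> B \<inter> V"
            then have "component h t (F - S) u \<in> ?W"
              using component_subset_closed[OF B(1), of u] by (auto simp: parts_def)
            then show "u \<in> \<Union>?W" using self_in_component[of u h t "F - S"] by blast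
          qed
        qed
        moreover have "E \<inter> bd h t (B \<inter> V) = E \<inter> bd h t B" using ends by (auto simp: mem_bd)
        ultimately have "odd (card (E \<inter> bd h t (\<Union>?W)))" using B by simp
        moreover have "pairwise disjnt ?W"
          using pairwise_disjnt_parts[of h t V "F - S"] by (rule pairwise_subset) auto
        ultimately show ?thesis using odd_bd_Union[OF E, of ?W h t] parts_fin by auto
      qed
      obtain Q1 where Q1: "Q1 \<in> ?P" "Q1 \<subseteq> A" "odd (card (E \<inter> bd h t Q1))"
        using find[OF clA oddA] by blast
      obtain Q2 where Q2: "Q2 \<in> ?P" "Q2 \<subseteq> - A" "odd (card (E \<inter> bd h t Q2))"
        using find[of "- A"] clA oddA by (auto simp: bd_Compl)
      have ne: "Q \<noteq> {}" "Q \<subseteq> V" if Q: "Q \<in> ?P" for Q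
      proof -
        obtain u where "u \<in> V" "Q = component h t (F - S) u" using Q by (auto simp: parts_def)
        then show "Q \<noteq> {}" "Q \<subseteq> V"
          using self_in_component[of u h t "F - S"] part_sub[of u "F - S"] FE by auto
      qed
      have Q12: "Q1 \<noteq> Q2" using Q1 Q2 ne by blast
      have four': "4 \<le> card (E \<inter> bd h t Q)" if Q: "Q \<in> ?P" for Q
      proof (rule four)
        show "Q \<inter> V \<noteq> {}" using ne[OF Q] by blast
        obtain Q' where Q': "Q' \<in> ?P" "Q' \<noteq> Q" using Q1 Q2 Q12 by blast
        then have "Q \<inter> Q' = {}"
          using pairwise_disjnt_parts[of h t V "F - S"] Q by (auto simp: pairwise_def disjnt_def)
        then show "\<not> V \<subseteq> Q" using ne[OF Q'(1)] by blast
      qed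
      define p where "p = card ?P"
      have p2: "p \<ge> 2"
        unfolding p_def using card_mono[OF parts_fin, of "{Q1, Q2}" "F - S"] Q1 Q2 Q12 by auto
      \<comment> \<open>The two odd parts send out at least \<open>k + 1\<close> edges each, every
        other part at least four.\<close>
      have lower: "2 * (k + 1) + 4 * (p - 2) \<le> (\<Sum>Q\<in>?P. card (E \<inter> bd h t Q))"
      proof -
        have "4 * (p - 2) = (\<Sum>Q\<in>?P - {Q1, Q2}. 4)"
          using Q1 Q2 Q12 parts_fin by (simp add: p_def card_Diff_subset)
        also have "\<dots> \<le> (\<Sum>Q\<in>?P - {Q1, Q2}. card (E \<inter> bd h t Q))"
          by (rule sum_mono) (use four' in auto)
        finally have "2 * (k + 1) + 4 * (p - 2) \<le> (\<Sum>Q\<in>?P - {Q1, Q2}. card (E \<inter> bd h t Q))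
            + (\<Sum>Q\<in>{Q1, Q2}. card (E \<inter> bd h t Q))"
          using odd[OF Q1(3)] odd[OF Q2(3)] Q12 by simp
        also have "\<dots> = (\<Sum>Q\<in>?P. card (E \<inter> bd h t Q))"
          using Q1 Q2 parts_fin by (intro sum.subset_diff[symmetric]) auto
        finally show ?thesis .
      qed
      let ?C = "{e \<in> E. \<not> conn h t (F - S) (h e) (t e)}"
      have fS: "finite S" using S E finite_subset by blast
      \<comment> \<open>An edge between different parts of \<open>F - S\<close> is not in
        \<open>F - S\<close>, so it lies in \<open>X\<close> or in
        \<open>S \<inter> F\<close>.\<close>
      have "?C \<subseteq> X \<union> (S \<inter> F \<inter> ?C)"
        using FE conn_edge[of _ "F - S" h t] by blast
      then have "card ?C \<le> card (X \<union> (S \<inter> F \<inter> ?C))"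
        using E XE finite_subset[OF XE E] fS by (intro card_mono) auto
      also have "\<dots> \<le> card X + card (S \<inter> F \<inter> ?C)" by (rule card_Un_le)
      finally have C: "card ?C \<le> card X + card (S \<inter> F \<inter> ?C)" .
      have upper: "2 * (k + 1) + 4 * (p - 2) \<le> 2 * (card X + card (S \<inter> F \<inter> ?C))"
        by (rule order_trans[OF order_trans[OF lower sum_bd_parts_le[OF E V(1)]] mult_le_mono2[OF C]])
      have "parts h t V E \<noteq> {}" using V by (simp add: parts_def)
      then have "card (parts h t V E) \<ge> 1" using parts_fin by (simp add: Suc_le_eq card_gt_0_iff)
      then have rE': "?r E \<le> int (card V) - 1" by (simp add: grank_def)
      have rI': "?r I \<le> int (card V) - 2" using False by (simp add: grank_def)
      have rFS: "?r (F - S) = int (card V) - int p" by (simp add: grank_def p_def)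
      \<comment> \<open>The min-max equality solved for \<open>card X\<close>, using that
        \<open>card I\<close> is the rank of \<open>I\<close>.\<close>
      have cX: "int (card X) = ?r I + ?r E - ?r F - ?r (F - S)"
        using I(1) rI XE by (simp add: r1_def r2_def F_def)
      show False
      \<comment> \<open>Without \<open>S\<close>-edges of \<open>F\<close> between parts,
        \<open>card X\<close> is at most \<open>2 * p - 3\<close>, and the two estimates force
        \<open>k \<le> 0\<close>. One such edge raises the rank of \<open>F\<close> by one, so
        \<open>card X\<close> is at most \<open>2 * p - 4\<close>; this beats the at most
        \<open>k\<close> extra edges.\<close>
      proof (cases "S \<inter> F \<inter> ?C = {}")
        case True
        have "?r (F - S) \<le> ?r F" using rank_fun_mono[OF R E, of "F - S" F] FE by auto
        then have "int (card X) \<le> 2 * int p - 3" using cX rI' rE' rFS by linarith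
        then show False using upper k p2 unfolding True by simp
      next
        case False
        then obtain e where e: "e \<in> F" "\<not> conn h t (F - S) (h e) (t e)" by blast
        have "?r (insert e (F - S)) \<le> ?r F" using rank_fun_mono[OF R E, of "insert e (F - S)" F] FE e by auto
        moreover have "?r (insert e (F - S)) = ?r (F - S) + 1"
          using e FE ends V by (subst grank_insert) auto
        ultimately have "int (card X) \<le> 2 * int p - 4" using cX rI' rE' rFS by linarith
        moreover have "card (S \<inter> F \<inter> ?C) \<le> card S" by (rule card_mono[OF fS]) blast
        then have "2 * (card X + card (S \<inter> F \<inter> ?C)) \<le> 2 * (card X + k)" using S(2) by simp
        then have "2 * (k + 1) + 4 * (p - 2) \<le> 2 * (card X + k)" by (rule order_trans[OF upper])
        ultimately show False using p2 by arith
      qed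
    qed
    then show ?thesis by (intro suff[of ?N]) auto
  qed
qed

section \<open>Bridgeless graphs\<close>

lemma even_linked_cong:
  assumes "\<And>x. x \<in> H \<Longrightarrow> h x = h' x \<and> t x = t' x"
  shows "even_edges h t H \<longleftrightarrow> even_edges h' t' H" "linked h t H \<longleftrightarrow> linked h' t' H"
proof -
  have bd: "H \<inter> bd h t A = H \<inter> bd h' t' A" for A using assms by (auto simp: mem_bd)
  have "h ` H = h' ` H" using assms by auto
  then show "even_edges h t H \<longleftrightarrow> even_edges h' t' H" "linked h t H \<longleftrightarrow> linked h' t' H"
    by (simp_all add: even_edges_def linked_def bd)
qed

lemma linkedI: "(\<And>x. x \<in> H \<Longrightarrow> conn h t H w (h x)) \<Longrightarrow> linked h t H"
  unfolding linked_def conn_def by blast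

text \<open>Since \<open>K\<close> is closed under \<open>D\<close>, a cut \<open>B\<close> missed
  by the edges in \<open>K\<close> yields the cut \<open>K \<inter> B\<close> missed by all of
  \<open>D\<close>.\<close>

lemma conn_in_component:
  assumes "D \<inter> bd h t K = {}" "conn h t D u v" "u \<in> K"
  shows "conn h t {x \<in> D. h x \<in> K} u v"
  unfolding conn_def
proof (intro allI impI)
  fix B assume "{x \<in> D. h x \<in> K} \<inter> bd h t B = {}"
  then have "D \<inter> bd h t (K \<inter> B) = {}" using assms(1) by (auto simp: bd_def)
  then have "u \<in> K \<inter> B \<longleftrightarrow> v \<in> K \<inter> B" using assms(2) unfolding conn_def by blast
  moreover have "v \<in> K" using assms unfolding conn_def by blast
  ultimately show "u \<in> B \<longleftrightarrow> v \<in> B" using assms(3) by blast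
qed

lemma restrict_bd:
  assumes "D \<inter> bd h t K = {}"
  shows "{x \<in> D. h x \<in> K} \<inter> bd h t B = D \<inter> bd h t (K \<inter> B)"
  using assms by (auto simp: bd_def)

text \<open>Keep only the component of \<open>u\<close> in a join. It contains \<open>v\<close>,
  since otherwise its empty boundary would have to be odd.\<close>

lemma conn_join_linked:
  assumes N: "finite N" and uv: "conn h t N u v"
  shows "\<exists>J\<subseteq>N. (\<forall>A. odd (card (J \<inter> bd h t A)) \<longleftrightarrow> (u \<in> A) \<noteq> (v \<in> A)) \<and> (\<forall>x\<in>J. conn h t J u (h x))"
proof -
  obtain P where P: "P \<subseteq> N" "\<And>A. odd (card (P \<inter> bd h t A)) \<longleftrightarrow> (u \<in> A) \<noteq> (v \<in> A)"
    using conn_join[OF N uv] by auto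
  define K where "K = component h t P u"
  have cl: "P \<inter> bd h t K = {}" unfolding K_def by (rule component_closed)
  have uK: "u \<in> K" unfolding K_def by (rule self_in_component)
  then have vK: "v \<in> K" using P(2)[of K] cl by simp
  let ?J = "{x \<in> P. h x \<in> K}"
  have "odd (card (?J \<inter> bd h t A)) \<longleftrightarrow> (u \<in> A) \<noteq> (v \<in> A)" for A
    unfolding restrict_bd[OF cl] P(2) using uK vK by blast
  moreover have "conn h t ?J u (h x)" if "x \<in> ?J" for x
    by (rule conn_in_component[OF cl _ uK]) (use that in \<open>simp add: K_def component_def\<close>)
  ultimately show ?thesis using P(1) by (intro exI[of _ ?J]) blast
qed

text \<open>As \<open>C\<close> is even, a join \<open>P\<close> and its complement in
  \<open>C\<close> have the same parities. If \<open>e\<close> is not in \<open>P\<close>, take its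
  component in \<open>C - P\<close>: if this contains \<open>u\<close> and \<open>v\<close> it is a
  join itself, otherwise it is even, touches \<open>P\<close> and can be added to it.\<close>

lemma join_through_edge:
  assumes C: "finite C" "even_edges h t C" "linked h t C"
    and e: "e \<in> C" and u: "u \<in> h ` C \<union> t ` C" and v: "v \<in> h ` C \<union> t ` C"
  shows "\<exists>R\<subseteq>C. e \<in> R \<and> (\<forall>A. odd (card (R \<inter> bd h t A)) \<longleftrightarrow> (u \<in> A) \<noteq> (v \<in> A)) \<and>
    (\<forall>x\<in>R. conn h t R u (h x))"
proof -
  have ends: "w \<in> A \<longleftrightarrow> h e \<in> A" if A: "C \<inter> bd h t A = {}" and w: "w \<in> h ` C \<union> t ` C" for A w
  proof -
    obtain x where x: "x \<in> C" "w = h x \<or> w = t x" using w by auto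
    have "h x \<in> A \<longleftrightarrow> h e \<in> A" using C(3) A x(1) e unfolding linked_def by blast
    moreover have "h x \<in> A \<longleftrightarrow> t x \<in> A" using A x(1) by (auto simp: mem_bd)
    ultimately show ?thesis using x(2) by auto
  qed
  have "conn h t C u v" unfolding conn_def using ends[OF _ u] ends[OF _ v] by simp
  then obtain P where P: "P \<subseteq> C" "\<And>A. odd (card (P \<inter> bd h t A)) \<longleftrightarrow> (u \<in> A) \<noteq> (v \<in> A)"
    "\<And>x. x \<in> P \<Longrightarrow> conn h t P u (h x)"
    using conn_join_linked[OF C(1), of h t u v] by auto
  show ?thesis
  proof (cases "e \<in> P")
    case True
    then show ?thesis using P by (intro exI[of _ P]) blast
  next
    case False
    define D where "D = C - P"
    define K where "K = component h t D (h e)"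
    define R where "R = {x \<in> D. h x \<in> K}"
    have cl: "D \<inter> bd h t K = {}" unfolding K_def by (rule component_closed)
    have eK: "h e \<in> K" unfolding K_def by (rule self_in_component)
    have eR: "e \<in> R" using e False eK by (simp add: R_def D_def)
    have parD: "odd (card (D \<inter> bd h t A)) \<longleftrightarrow> (u \<in> A) \<noteq> (v \<in> A)" for A
      unfolding D_def using odd_card_Diff[OF C(1) P(1), of "bd h t A"] C(2) P(2)
      by (simp add: even_edges_def)
    then have uvK: "u \<in> K \<longleftrightarrow> v \<in> K" using cl by (metis card.empty even_zero)
    have parR: "odd (card (R \<inter> bd h t A)) \<longleftrightarrow> (u \<in> K \<inter> A) \<noteq> (v \<in> K \<inter> A)" for A
      unfolding R_def restrict_bd[OF cl] parD by blast
    have connR: "conn h t R (h e) w" if "w \<in> K" for w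
      unfolding R_def by (rule conn_in_component[OF cl _ eK]) (use that in \<open>simp add: K_def component_def\<close>)
    show ?thesis
    proof (cases "u \<in> K")
      case True
      have "conn h t R u (h x)" if "x \<in> R" for x
        using connR[OF True] connR[of "h x"] that conn_trans conn_sym unfolding R_def by fast
      then show ?thesis using eR parR True uvK by (intro exI[of _ R]) (auto simp: R_def D_def)
    next
      case uK: False
      \<comment> \<open>\<open>C\<close> is linked, so some edge of \<open>C\<close> leaves
        \<open>K\<close>; it must come from \<open>P\<close>, because \<open>K\<close> is closed
        under \<open>D\<close>.\<close>
      have "\<exists>x\<in>P. x \<in> bd h t K"
      proof (rule ccontr)
        assume "\<not> ?thesis"
        then have "C \<inter> bd h t K = {}" using cl by (auto simp: D_def)
        then show False using ends[OF _ u, of K] eK uK by simp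
      qed
      then obtain x where x: "x \<in> P" "x \<in> bd h t K" by blast
      let ?Q = "P \<union> R"
      have PQ: "conn h t ?Q a b" if "conn h t P a b" for a b using conn_mono[OF that] by blast
      have RQ: "conn h t ?Q a b" if "conn h t R a b" for a b using conn_mono[OF that] by blast
      have uhx: "conn h t ?Q u (h x)" using P(3)[OF x(1)] by (rule PQ)
      have "conn h t ?Q (h x) (t x)" using x(1) by (intro conn_edge) blast
      then have "conn h t ?Q u (t x)" using uhx by (rule conn_trans[rotated])
      then have "conn h t ?Q (h e) u"
        using x(2) uhx connR[of "h x"] connR[of "t x"] RQ conn_trans conn_sym unfolding mem_bd by metis
      then have ue: "conn h t ?Q u (h e)" by (rule conn_sym)
      have "conn h t ?Q u (h y)" if "y \<in> ?Q" for y
      proof (cases "y \<in> P")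
        case True
        then show ?thesis using P(3) PQ by blast
      next
        case False
        then have "h y \<in> K" using that by (simp add: R_def)
        then show ?thesis using connR RQ ue conn_trans by fast
      qed
      moreover have "odd (card (?Q \<inter> bd h t A)) \<longleftrightarrow> (u \<in> A) \<noteq> (v \<in> A)" for A
      proof -
        have "finite P" "finite R" "P \<inter> R = {}"
          using C(1) P(1) by (auto simp: R_def D_def intro: finite_subset)
        then have "odd (card (?Q \<inter> bd h t A)) \<longleftrightarrow> odd (card (P \<inter> bd h t A)) \<noteq> odd (card (R \<inter> bd h t A))"
          by (rule odd_card_Un)
        then show ?thesis using P(2) parR uK uvK by simp
      qed
      moreover have "?Q \<subseteq> C" using P(1) by (auto simp: R_def D_def)
      ultimately show ?thesis using eR by (intro exI[of _ ?Q]) blast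
    qed
  qed
qed

text \<open>The edge sets of circuits, up to Euler's theorem.\<close>

definition common_circuit :: "('e \<Rightarrow> 'v) \<Rightarrow> ('e \<Rightarrow> 'v) \<Rightarrow> 'e set \<Rightarrow> 'e set \<Rightarrow> bool" where
  "common_circuit h t E S \<longleftrightarrow> (\<exists>H\<subseteq>E. S \<subseteq> H \<and> even_edges h t H \<and> linked h t H)"

text \<open>Leave \<open>C\<close> at \<open>w\<close> along \<open>x\<close>, return to a vertex
  \<open>c\<close> of \<open>C\<close> by edges outside \<open>C\<close>, and close up inside
  \<open>C\<close> by a join from \<open>w\<close> to \<open>c\<close> through
  \<open>e\<close>.\<close>

lemma extend_circuit:
  assumes E: "finite E" and bridgeless: "\<And>A. card (E \<inter> bd h t A) \<noteq> 1"
    and C: "C \<subseteq> E" "even_edges h t C" "linked h t C" and e: "e \<in> C"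
    and x: "x \<in> E" and w: "w \<in> h ` C \<union> t ` C" and wy: "h x = w \<and> t x = y \<or> h x = y \<and> t x = w"
  shows "common_circuit h t E {e, x}"
proof (cases "x \<in> C")
  case True
  then show ?thesis using C e by (auto simp: common_circuit_def)
next
  case False
  define F where "F = E - C - {x}"
  define K where "K = component h t F y"
  have cl: "F \<inter> bd h t K = {}" unfolding K_def by (rule component_closed)
  have yK: "y \<in> K" unfolding K_def by (rule self_in_component)
  \<comment> \<open>Otherwise \<open>x\<close> would be the only edge leaving \<open>K\<close>, that
    is, a bridge.\<close>
  have "\<exists>c\<in>h ` C \<union> t ` C. c \<in> K"
  proof (rule ccontr)
    assume "\<not> ?thesis"
    then have no: "c \<notin> K" if "c \<in> h ` C \<union> t ` C" for c using that by blast
    then have "C \<inter> bd h t K = {}" by (auto simp: mem_bd)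
    moreover have "x \<in> bd h t K" using wy yK no[OF w] by (auto simp: mem_bd)
    ultimately have "E \<inter> bd h t K = {x}" using cl x by (auto simp: F_def)
    then show False using bridgeless[of K] by simp
  qed
  then obtain c where c: "c \<in> h ` C \<union> t ` C" "c \<in> K" by blast
  have fC: "finite C" using C(1) E finite_subset by blast
  have fF: "finite F" using E by (simp add: F_def)
  have "conn h t F y c" using c(2) by (simp add: K_def component_def)
  then obtain P where P: "P \<subseteq> F" "\<And>A. odd (card (P \<inter> bd h t A)) \<longleftrightarrow> (y \<in> A) \<noteq> (c \<in> A)"
    "\<And>z. z \<in> P \<Longrightarrow> conn h t P y (h z)"
    using conn_join_linked[OF fF, of h t y c] by auto
  obtain R where R: "R \<subseteq> C" "e \<in> R" "\<And>A. odd (card (R \<inter> bd h t A)) \<longleftrightarrow> (w \<in> A) \<noteq> (c \<in> A)"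
    "\<And>z. z \<in> R \<Longrightarrow> conn h t R w (h z)"
    using join_through_edge[OF fC C(2,3) e w c(1)] by auto
  let ?H = "insert x (R \<union> P)"
  have fin: "finite R" "finite P" "R \<inter> P = {}" "x \<notin> R \<union> P"
    using R(1) P(1) fC fF False finite_subset unfolding F_def by blast+
  have "even (card (?H \<inter> bd h t A))" for A
  proof -
    have "x \<in> bd h t A \<longleftrightarrow> (w \<in> A) \<noteq> (y \<in> A)" using wy by (auto simp: mem_bd)
    then show ?thesis
      using odd_card_insert[of "R \<union> P" x "bd h t A"] odd_card_Un[OF fin(1-3), of "bd h t A"] fin
        P(2)[of A] R(3)[of A] by blast
  qed
  then have "even_edges h t ?H" by (simp add: even_edges_def)
  moreover have "linked h t ?H"
  proof (rule linkedI)
    fix z assume z: "z \<in> ?H"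
    have "conn h t ?H (h x) (t x)" by (intro conn_edge) blast
    then have wy': "conn h t ?H w y" using wy conn_sym[of h t ?H "h x" "t x"] by auto
    have RH: "conn h t ?H w (h z)" if "z \<in> R" by (rule conn_mono[OF R(4)[OF that]]) auto
    have PH: "conn h t ?H y (h z)" if "z \<in> P" by (rule conn_mono[OF P(3)[OF that]]) auto
    from z consider "z = x" | "z \<in> R" | "z \<in> P" by blast
    then show "conn h t ?H w (h z)"
    proof cases
      case 1
      then show ?thesis using wy wy' conn_refl[of h t ?H w] by auto
    next
      case 2
      then show ?thesis by (rule RH)
    next
      case 3
      then show ?thesis using conn_trans[OF wy' PH] by simp
    qed
  qed
  moreover have "?H \<subseteq> E" using R(1) C(1) P(1) x by (auto simp: F_def)
  ultimately show ?thesis unfolding common_circuit_def using R(2) by (intro exI[of _ ?H]) blast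
qed

text \<open>The set \<open>M\<close> of edges on a common circuit with \<open>e\<close> contains
  \<open>e\<close>, which is no bridge, and is closed under adjacency by
  \<open>extend_circuit\<close>; connectedness makes it all of \<open>E\<close>.\<close>

lemma bridgeless_two_edges:
  assumes E: "finite E" and bridgeless: "\<And>A. card (E \<inter> bd h t A) \<noteq> 1"
    and connected: "\<And>A. A \<inter> V \<noteq> {} \<Longrightarrow> \<not> V \<subseteq> A \<Longrightarrow> E \<inter> bd h t A \<noteq> {}"
    and im: "h ` E \<union> t ` E \<subseteq> V" and e: "e \<in> E" and f: "f \<in> E"
  shows "common_circuit h t E {e, f}"
proof -
  define M where "M = {g \<in> E. common_circuit h t E {e, g}}"
  have "e \<in> M"
  proof -
    have "\<not> (E - {e}) \<inter> bd h t A = {} \<or> (h e \<in> A \<longleftrightarrow> t e \<in> A)" for A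
    proof (rule ccontr)
      assume "\<not> ?thesis"
      then have "E \<inter> bd h t A = {e}" using e by (auto simp: mem_bd)
      then show False using bridgeless[of A] by simp
    qed
    then have "conn h t (E - {e}) (h e) (t e)" unfolding conn_def by blast
    then obtain P where P: "P \<subseteq> E - {e}" "\<And>A. odd (card (P \<inter> bd h t A)) \<longleftrightarrow> (h e \<in> A) \<noteq> (t e \<in> A)"
      "\<And>z. z \<in> P \<Longrightarrow> conn h t P (h e) (h z)"
      using conn_join_linked[of "E - {e}" h t "h e" "t e"] E by auto
    have fin: "finite P" "e \<notin> P" using P(1) E finite_subset by auto
    have "even (card (insert e P \<inter> bd h t A))" for A
      using odd_card_insert[OF fin, of "bd h t A"] P(2)[of A] by (auto simp: mem_bd)
    then have "even_edges h t (insert e P)" by (simp add: even_edges_def)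
    moreover have "linked h t (insert e P)"
    proof (rule linkedI)
      fix z assume "z \<in> insert e P"
      then show "conn h t (insert e P) (h e) (h z)"
        using conn_refl conn_mono[OF P(3)[of z], of "insert e P"] by (cases "z = e") auto
    qed
    ultimately show ?thesis using e P(1) unfolding M_def common_circuit_def
      by (auto intro!: exI[of _ "insert e P"])
  qed
  moreover have step: "g \<in> M" if g: "g \<in> E" "h g \<in> h ` M \<union> t ` M \<or> t g \<in> h ` M \<union> t ` M" for g
  proof -
    obtain w y where wy: "h g = w \<and> t g = y \<or> h g = y \<and> t g = w" "w \<in> h ` M \<union> t ` M"
      using g(2) by metis
    from wy(2) obtain m where m: "m \<in> M" "w = h m \<or> w = t m" by auto
    from m(1) obtain C where C: "C \<subseteq> E" "e \<in> C" "m \<in> C" "even_edges h t C" "linked h t C"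
      by (auto simp: M_def common_circuit_def)
    have "w \<in> h ` C \<union> t ` C" using m(2) C(3) by auto
    from extend_circuit[OF E bridgeless C(1,4,5,2) g(1) this wy(1)]
    show ?thesis using g(1) by (simp add: M_def)
  qed
  ultimately have "f \<in> M"
  proof -
    let ?A = "h ` M \<union> t ` M"
    have cl: "E \<inter> bd h t ?A = {}"
    proof (rule ccontr)
      assume "E \<inter> bd h t ?A \<noteq> {}"
      then obtain g where g: "g \<in> E" "(h g \<in> ?A) \<noteq> (t g \<in> ?A)" unfolding bd_def by blast
      then have "g \<in> M" using step[OF g(1)] by metis
      then show False using g(2) by simp
    qed
    have "h e \<in> ?A \<inter> V" using \<open>e \<in> M\<close> im e by auto
    then have "?A \<inter> V \<noteq> {}" by blast
    then have "V \<subseteq> ?A" using connected[of ?A] cl by metis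
    moreover have "h f \<in> V" using im f by auto
    ultimately have "h f \<in> ?A" by (rule subsetD)
    then show ?thesis by (rule step[OF f disjI1])
  qed
  then show ?thesis by (simp add: M_def)
qed

section \<open>Two-edge cuts\<close>

definition inner :: "('e \<Rightarrow> 'v) \<Rightarrow> ('e \<Rightarrow> 'v) \<Rightarrow> 'e set \<Rightarrow> 'v set \<Rightarrow> 'e set" where
  "inner h t E A = {x \<in> E. h x \<in> A \<and> t x \<in> A}"

text \<open>Contracts the complement of \<open>A\<close> into \<open>a\<close>.\<close>

definition collapse :: "'v set \<Rightarrow> 'v \<Rightarrow> 'v \<Rightarrow> 'v" where
  "collapse A a v = (if v \<in> A then v else a)"

text \<open>The hypotheses of the theorem for multigraphs, entirely in terms of cuts and thus
  inherited under contraction.\<close>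

definition odd_cut_free :: "nat \<Rightarrow> ('e \<Rightarrow> 'v) \<Rightarrow> ('e \<Rightarrow> 'v) \<Rightarrow> 'v set \<Rightarrow> 'e set \<Rightarrow> bool" where
  "odd_cut_free k h t V E \<longleftrightarrow> finite V \<and> V \<noteq> {} \<and> finite E \<and> h ` E \<union> t ` E \<subseteq> V \<and>
     (\<forall>A. A \<inter> V \<noteq> {} \<longrightarrow> \<not> V \<subseteq> A \<longrightarrow> E \<inter> bd h t A \<noteq> {}) \<and>
     (\<forall>A. odd (card (E \<inter> bd h t A)) \<longrightarrow> k < card (E \<inter> bd h t A))"

text \<open>All edges outside \<open>A\<close> become loops at \<open>a\<close>, and so does
  \<open>f\<close>, whose ends are \<open>a\<close> and \<open>b\<close>. Dropping these loops
  changes no cut, so the cuts of the contraction are cuts of the original graph.\<close>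

lemma bd_collapse:
  assumes "E \<inter> bd h t A = {e, f}" "e \<noteq> f" "a \<in> A" "b \<notin> A"
    and "h f = a \<and> t f = b \<or> h f = b \<and> t f = a"
  shows "insert e (inner h t E A) \<inter> bd (collapse A a \<circ> h) (collapse A a \<circ> t) B =
    E \<inter> bd h t (collapse A a -` B)"
proof -
  have "x \<in> insert e (inner h t E A) \<inter> bd (collapse A a \<circ> h) (collapse A a \<circ> t) B \<longleftrightarrow>
      x \<in> E \<inter> bd h t (collapse A a -` B)" for x
  proof (cases "x \<in> E")
    case True
    then have x: "(h x \<in> A) \<noteq> (t x \<in> A) \<longleftrightarrow> x = e \<or> x = f" using assms(1) by (auto simp: bd_def)
    show ?thesis
    proof (cases "x = f")
      case True
      then show ?thesis using assms by (auto simp: inner_def mem_bd collapse_def)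
    next
      case False
      show ?thesis using x False \<open>x \<in> E\<close> by (auto simp: inner_def mem_bd collapse_def)
    qed
  next
    case False
    moreover have "e \<in> E" using assms(1) by blast
    ultimately show ?thesis by (auto simp: inner_def)
  qed
  then show ?thesis by blast
qed

lemma odd_cut_free_collapse:
  assumes G: "odd_cut_free k h t V E" and ef: "E \<inter> bd h t A = {e, f}" "e \<noteq> f" and ab: "a \<in> A" "b \<notin> A"
    and f: "h f = a \<and> t f = b \<or> h f = b \<and> t f = a"
  shows "odd_cut_free k (collapse A a \<circ> h) (collapse A a \<circ> t) (V \<inter> A) (insert e (inner h t E A))"
    "card (insert e (inner h t E A)) < card E"
proof -
  note bd = bd_collapse[OF ef ab f]
  have G': "finite V" "finite E" "h ` E \<union> t ` E \<subseteq> V"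
    "\<And>A. A \<inter> V \<noteq> {} \<Longrightarrow> \<not> V \<subseteq> A \<Longrightarrow> E \<inter> bd h t A \<noteq> {}"
    "\<And>A. odd (card (E \<inter> bd h t A)) \<Longrightarrow> k < card (E \<inter> bd h t A)"
    using G by (auto simp: odd_cut_free_def)
  have fE: "f \<in> E" "e \<in> E" using ef by auto
  have ends: "h x \<in> V" "t x \<in> V" if "x \<in> E" for x using G'(3) that by auto
  have aV: "a \<in> V" using ends[OF fE(1)] f by auto
  have sub: "insert e (inner h t E A) \<subseteq> E" using fE by (auto simp: inner_def)
  have c1: "insert e (inner h t E A) \<inter> bd (collapse A a \<circ> h) (collapse A a \<circ> t) B \<noteq> {}"
    if "B \<inter> (V \<inter> A) \<noteq> {}" "\<not> V \<inter> A \<subseteq> B" for B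
    unfolding bd
  proof (rule G'(4))
    show "collapse A a -` B \<inter> V \<noteq> {}" using that(1) by (auto simp: collapse_def)
    show "\<not> V \<subseteq> collapse A a -` B" using that(2) by (auto simp: collapse_def subset_iff)
  qed
  have c2: "k < card (insert e (inner h t E A) \<inter> bd (collapse A a \<circ> h) (collapse A a \<circ> t) B)"
    if "odd (card (insert e (inner h t E A) \<inter> bd (collapse A a \<circ> h) (collapse A a \<circ> t) B))" for B
    using G'(5) that unfolding bd .
  have c3: "(collapse A a \<circ> h) ` insert e (inner h t E A) \<union> (collapse A a \<circ> t) ` insert e (inner h t E A) \<subseteq> V \<inter> A"
  proof -
    have "collapse A a (h x) \<in> V \<inter> A" "collapse A a (t x) \<in> V \<inter> A" if "x \<in> E" for x
      using ends[OF that] aV ab by (auto simp: collapse_def)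
    then show ?thesis using subsetD[OF sub] by (intro Un_least image_subsetI) (simp_all only: comp_apply)
  qed
  have c4: "finite (insert e (inner h t E A))" using sub G'(2) by (rule finite_subset)
  have "finite (V \<inter> A)" "V \<inter> A \<noteq> {}" using G'(1) aV ab by auto
  then show "odd_cut_free k (collapse A a \<circ> h) (collapse A a \<circ> t) (V \<inter> A) (insert e (inner h t E A))"
    unfolding odd_cut_free_def using c1 c2 c3 c4 by (intro conjI allI impI) assumption+
  have "f \<notin> insert e (inner h t E A)" using ef f ab by (auto simp: inner_def)
  then show "card (insert e (inner h t E A)) < card E"
    using sub fE G'(2) by (intro psubset_card_mono) auto
qed

text \<open>In the contraction \<open>e\<close> runs from its end in \<open>A\<close> to
  \<open>a\<close>, so \<open>H - {e}\<close> joins these two vertices; likewise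
  \<open>K - {e}\<close> joins the other end of \<open>e\<close> to \<open>b\<close>. The edges
  \<open>e\<close> and \<open>f\<close> close the two joins to a circuit.\<close>

lemma glue_circuits:
  assumes E: "finite E" and ef: "E \<inter> bd h t A = {e, f}" "e \<noteq> f" and ab: "a \<in> A" "b \<notin> A"
    and f: "h f = a \<and> t f = b \<or> h f = b \<and> t f = a"
    and H: "H \<subseteq> insert e (inner h t E A)" "e \<in> H"
      "even_edges (collapse A a \<circ> h) (collapse A a \<circ> t) H" "linked (collapse A a \<circ> h) (collapse A a \<circ> t) H"
    and K: "K \<subseteq> insert e (inner h t E (- A))" "e \<in> K"
      "even_edges (collapse (- A) b \<circ> h) (collapse (- A) b \<circ> t) K" "linked (collapse (- A) b \<circ> h) (collapse (- A) b \<circ> t) K"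
  shows "even_edges h t (insert f (H \<union> K))" "linked h t (insert f (H \<union> K))"
proof -
  let ?h = "collapse A a \<circ> h" and ?t = "collapse A a \<circ> t"
  let ?h' = "collapse (- A) b \<circ> h" and ?t' = "collapse (- A) b \<circ> t"
  define H0 where "H0 = H - {e}"
  define K0 where "K0 = K - {e}"
  have e: "(h e \<in> A) \<noteq> (t e \<in> A)" using ef by (auto simp: bd_def)
  have H0: "h x \<in> A" "t x \<in> A" "x \<in> E" "x \<noteq> e" "x \<noteq> f" if "x \<in> H0" for x
    using that H(1) f ab by (auto simp: H0_def inner_def)
  have K0: "h x \<notin> A" "t x \<notin> A" "x \<in> E" "x \<noteq> e" "x \<noteq> f" if "x \<in> K0" for x
    using that K(1) f ab by (auto simp: K0_def inner_def)
  have HK: "H = insert e H0" "K = insert e K0" using H(2) K(2) by (auto simp: H0_def K0_def)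
  have fin: "finite H0" "finite K0" using H0(3) K0(3) E by (meson finite_subset subsetI)+
  have dis: "H0 \<inter> K0 = {}" "e \<notin> H0" "e \<notin> K0" "e \<notin> H0 \<union> K0" "f \<notin> insert e (H0 \<union> K0)"
    using H0(1,4,5) K0(1,4,5) ef(2) by blast+
  have bdH: "H0 \<inter> bd ?h ?t B = H0 \<inter> bd h t B" for B using H0(1,2) by (auto simp: mem_bd collapse_def)
  have bdK: "K0 \<inter> bd ?h' ?t' B = K0 \<inter> bd h t B" for B using K0(1,2) by (auto simp: mem_bd collapse_def)
  have parH: "odd (card (H0 \<inter> bd h t B)) \<longleftrightarrow> e \<in> bd ?h ?t B" for B
    using H(3) odd_card_insert[OF fin(1) dis(2), of "bd ?h ?t B"]
    unfolding even_edges_def HK(1) bdH by blast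
  have parK: "odd (card (K0 \<inter> bd h t B)) \<longleftrightarrow> e \<in> bd ?h' ?t' B" for B
    using K(3) odd_card_insert[OF fin(2) dis(3), of "bd ?h' ?t' B"]
    unfolding even_edges_def HK(2) bdK by blast
  have ins: "insert f (H \<union> K) = insert f (insert e (H0 \<union> K0))" using HK by auto
  have par: "odd (card (insert f (H \<union> K) \<inter> bd h t B)) \<longleftrightarrow>
      (((e \<in> bd ?h ?t B) \<noteq> (e \<in> bd ?h' ?t' B)) \<noteq> (e \<in> bd h t B)) \<noteq> (f \<in> bd h t B)" for B
  proof -
    have fU: "finite (H0 \<union> K0)" "finite (insert e (H0 \<union> K0))" using fin by auto
    show ?thesis
      unfolding ins odd_card_insert[OF fU(2) dis(5)] odd_card_insert[OF fU(1) dis(4)]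
        odd_card_Un[OF fin dis(1)] parH parK by (rule refl)
  qed
  show "even_edges h t (insert f (H \<union> K))"
    unfolding even_edges_def
  proof
    fix B
    show "even (card (insert f (H \<union> K) \<inter> bd h t B))"
      using par[of B] e f unfolding mem_bd by (auto simp: collapse_def)
  qed
  show "linked h t (insert f (H \<union> K))"
    unfolding linked_def
  proof (intro allI impI)
    fix B assume B: "insert f (H \<union> K) \<inter> bd h t B = {}"
    \<comment> \<open>A missed cut is even on \<open>H0\<close> and \<open>K0\<close>, so
      \<open>e\<close> cannot cross it in either contraction either. Hence linkedness of
      \<open>H\<close> and of \<open>K\<close> applies, and \<open>a\<close>, \<open>b\<close> and
      the ends of \<open>e\<close> all lie on one side.\<close>
    have "H0 \<inter> bd h t B = {}" "K0 \<inter> bd h t B = {}" using B HK by auto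
    then have eB: "e \<notin> bd ?h ?t B" "e \<notin> bd ?h' ?t' B" using parH[of B] parK[of B] by auto
    then have "H \<inter> bd ?h ?t B = {}" "K \<inter> bd ?h' ?t' B = {}"
      unfolding HK using bdH[of B] bdK[of B] \<open>H0 \<inter> bd h t B = {}\<close> \<open>K0 \<inter> bd h t B = {}\<close> by auto
    then have LH: "?h ` H \<subseteq> B \<or> ?h ` H \<inter> B = {}" and LK: "?h' ` K \<subseteq> B \<or> ?h' ` K \<inter> B = {}"
      using H(4) K(4) by (auto simp: linked_def)
    have LH': "?h x \<in> B \<longleftrightarrow> ?h e \<in> B" if "x \<in> H" for x using LH that H(2) by auto
    have LK': "?h' x \<in> B \<longleftrightarrow> ?h' e \<in> B" if "x \<in> K" for x using LK that K(2) by auto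
    have "e \<notin> bd h t B" "f \<notin> bd h t B" using B H(2) by auto
    then have base: "a \<in> B \<longleftrightarrow> b \<in> B" "h e \<in> B \<longleftrightarrow> a \<in> B" "?h e \<in> B \<longleftrightarrow> a \<in> B" "?h' e \<in> B \<longleftrightarrow> a \<in> B"
      using eB e f unfolding mem_bd by (auto simp: collapse_def)
    have "h x \<in> B \<longleftrightarrow> a \<in> B" if x: "x \<in> insert f (H \<union> K)" for x
    proof -
      from x consider "x = f" | "x = e" | "x \<in> H0" | "x \<in> K0" using ins by blast
      then show ?thesis
      proof cases
        case 1
        then show ?thesis using f base by auto
      next
        case 2
        then show ?thesis using base by auto
      next
        case 3
        then show ?thesis using LH'[of x] H0(1)[of x] base HK by (auto simp: collapse_def)
      next
        case 4
        then show ?thesis using LK'[of x] K0(1)[of x] base HK by (auto simp: collapse_def)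
      qed
    qed
    then show "h ` insert f (H \<union> K) \<subseteq> B \<or> h ` insert f (H \<union> K) \<inter> B = {}" by blast
  qed
qed

text \<open>A circuit that stays inside \<open>A\<close> does not feel the contraction, because
  \<open>collapse\<close> fixes \<open>A\<close>.\<close>

lemma common_circuit_inner:
  assumes "H \<subseteq> inner h t E A" "S \<subseteq> H"
    "even_edges (collapse A a \<circ> h) (collapse A a \<circ> t) H" "linked (collapse A a \<circ> h) (collapse A a \<circ> t) H"
  shows "common_circuit h t E S"
proof -
  have "(collapse A a \<circ> h) x = h x \<and> (collapse A a \<circ> t) x = t x" if "x \<in> H" for x
    using that assms(1) by (auto simp: inner_def collapse_def)
  then have "even_edges h t H" "linked h t H"
    using assms(3,4) even_linked_cong[of H "collapse A a \<circ> h" h "collapse A a \<circ> t" t] by auto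
  then show ?thesis using assms by (auto simp: common_circuit_def inner_def)
qed

lemma two_edge_cut_case:
  assumes E: "finite E" and ef: "E \<inter> bd h t A = {e, f}" "e \<noteq> f" and ab: "a \<in> A" "b \<notin> A"
    and f: "h f = a \<and> t f = b \<or> h f = b \<and> t f = a"
    and solA: "\<And>S. S \<subseteq> insert e (inner h t E A) \<Longrightarrow> card S \<le> k \<Longrightarrow>
      common_circuit (collapse A a \<circ> h) (collapse A a \<circ> t) (insert e (inner h t E A)) S"
    and solB: "\<And>S. S \<subseteq> insert e (inner h t E (- A)) \<Longrightarrow> card S \<le> k \<Longrightarrow>
      common_circuit (collapse (- A) b \<circ> h) (collapse (- A) b \<circ> t) (insert e (inner h t E (- A))) S"
    and S: "S \<subseteq> E" "card S \<le> k" and k: "1 \<le> k"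
  shows "common_circuit h t E S"
proof -
  let ?h = "collapse A a \<circ> h" and ?t = "collapse A a \<circ> t"
  let ?h' = "collapse (- A) b \<circ> h" and ?t' = "collapse (- A) b \<circ> t"
  let ?I = "inner h t E A" and ?I' = "inner h t E (- A)"
  have efE: "e \<in> E" "f \<in> E" using ef by auto
  have cover: "x = e \<or> x = f \<or> x \<in> ?I \<or> x \<in> ?I'" if "x \<in> E" for x
    using that ef(1) by (auto simp: inner_def bd_def)
  have glue: "common_circuit h t E S"
    if "S \<subseteq> insert f (H \<union> K)" "H \<subseteq> insert e ?I" "e \<in> H" "even_edges ?h ?t H" "linked ?h ?t H"
      "K \<subseteq> insert e ?I'" "e \<in> K" "even_edges ?h' ?t' K" "linked ?h' ?t' K" for H K
  proof -
    have "insert f (H \<union> K) \<subseteq> E" using that(2,6) efE by (auto simp: inner_def)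
    then show ?thesis
      using glue_circuits[OF E ef ab f that(2-)] that(1) unfolding common_circuit_def by blast
  qed
  have fS: "finite S" using S E finite_subset by blast
  \<comment> \<open>At least one edge of \<open>S\<close> lies outside \<open>?I\<close>, which
    leaves room for \<open>e\<close> within the bound \<open>k\<close>.\<close>
  have SA: "common_circuit ?h ?t (insert e ?I) (insert e (S \<inter> ?I))" if "\<not> S \<subseteq> ?I"
  proof (rule solA)
    have "card (S \<inter> ?I) < card S" using fS that by (intro psubset_card_mono) auto
    then show "card (insert e (S \<inter> ?I)) \<le> k" using S(2) card_insert_le_m1[of k "S \<inter> ?I" e] k by linarith
  qed auto
  have SB: "common_circuit ?h' ?t' (insert e ?I') (insert e (S \<inter> ?I'))" if "\<not> S \<subseteq> ?I'"
  proof (rule solB)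
    have "card (S \<inter> ?I') < card S" using fS that by (intro psubset_card_mono) auto
    then show "card (insert e (S \<inter> ?I')) \<le> k" using S(2) card_insert_le_m1[of k "S \<inter> ?I'" e] k by linarith
  qed auto
  consider "S \<subseteq> ?I" | "S \<subseteq> ?I'" | "\<not> S \<subseteq> ?I" "\<not> S \<subseteq> ?I'" by blast
  then show ?thesis
  proof cases
    case 1
    have "common_circuit ?h ?t (insert e ?I) S" using 1 S(2) by (intro solA) auto
    then obtain H where H: "H \<subseteq> insert e ?I" "S \<subseteq> H" "even_edges ?h ?t H" "linked ?h ?t H"
      by (auto simp: common_circuit_def)
    \<comment> \<open>Any circuit through \<open>e\<close> on the other side will do for gluing; it
      is used only if \<open>H\<close> passes through \<open>e\<close>.\<close>
    have "common_circuit ?h' ?t' (insert e ?I') {e}" using k by (intro solB) auto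
    then obtain K where K: "K \<subseteq> insert e ?I'" "e \<in> K" "even_edges ?h' ?t' K" "linked ?h' ?t' K"
      by (auto simp: common_circuit_def)
    show ?thesis
    proof (cases "e \<in> H")
      case True
      then show ?thesis using H K by (intro glue[of H K]) auto
    next
      case False
      then show ?thesis using H by (intro common_circuit_inner[of H h t E A S a]) auto
    qed
  next
    case 2
    have "common_circuit ?h' ?t' (insert e ?I') S" using 2 S(2) by (intro solB) auto
    then obtain K where K: "K \<subseteq> insert e ?I'" "S \<subseteq> K" "even_edges ?h' ?t' K" "linked ?h' ?t' K"
      by (auto simp: common_circuit_def)
    have "common_circuit ?h ?t (insert e ?I) {e}" using k by (intro solA) auto
    then obtain H where H: "H \<subseteq> insert e ?I" "e \<in> H" "even_edges ?h ?t H" "linked ?h ?t H"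
      by (auto simp: common_circuit_def)
    show ?thesis
    proof (cases "e \<in> K")
      case True
      then show ?thesis using H K by (intro glue[of H K]) auto
    next
      case False
      then show ?thesis using K by (intro common_circuit_inner[of K h t E "- A" S b]) auto
    qed
  next
    case 3
    obtain H where H: "H \<subseteq> insert e ?I" "insert e (S \<inter> ?I) \<subseteq> H" "even_edges ?h ?t H" "linked ?h ?t H"
      using SA[OF 3(1)] by (auto simp: common_circuit_def)
    obtain K where K: "K \<subseteq> insert e ?I'" "insert e (S \<inter> ?I') \<subseteq> K" "even_edges ?h' ?t' K" "linked ?h' ?t' K"
      using SB[OF 3(2)] by (auto simp: common_circuit_def)
    have "S \<subseteq> insert f (H \<union> K)" using H(2) K(2) cover S(1) by blast
    then show ?thesis using H K by (intro glue[of H K]) auto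
  qed
qed

text \<open>Induction on the number of edges along two-edge cuts. When none is left, separating cuts
  have at least four edges, since sizes 1 and 3 are odd and at most \<open>k\<close>.\<close>

lemma odd_cut_free_common_circuit_ge_3:
  assumes "odd_cut_free k h t V E" "S \<subseteq> E" "card S \<le> k" and k: "3 \<le> k"
  shows "common_circuit h t E S"
  using assms(1-3)
proof (induction "card E" arbitrary: h t V E S rule: less_induct)
  case less
  note G = less.prems(1)
  have G': "finite V" "V \<noteq> {}" "finite E" "h ` E \<union> t ` E \<subseteq> V"
    "\<And>A. A \<inter> V \<noteq> {} \<Longrightarrow> \<not> V \<subseteq> A \<Longrightarrow> E \<inter> bd h t A \<noteq> {}"
    "\<And>A. odd (card (E \<inter> bd h t A)) \<Longrightarrow> k < card (E \<inter> bd h t A)"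
    using G by (auto simp: odd_cut_free_def)
  show ?case
  proof (cases "\<exists>A. card (E \<inter> bd h t A) = 2")
    case False
    have "4 \<le> card (E \<inter> bd h t A)" if "A \<inter> V \<noteq> {}" "\<not> V \<subseteq> A" for A
    proof -
      have "card (E \<inter> bd h t A) \<noteq> 0" using G'(5)[OF that] G'(3) by simp
      moreover have "card (E \<inter> bd h t A) \<noteq> 1" "card (E \<inter> bd h t A) \<noteq> 3"
        using G'(6)[of A] k by auto
      moreover have "card (E \<inter> bd h t A) \<noteq> 2" using False by blast
      ultimately show ?thesis by linarith
    qed
    then show ?thesis unfolding common_circuit_def
      using k by (intro four_edge_connected_case[OF G'(1-4) less.prems(2,3) _ G'(6)]) auto
  next
    case True
    then obtain A e f where ef: "E \<inter> bd h t A = {e, f}" "e \<noteq> f" by (metis card_2_iff)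
    have "f \<in> bd h t A" using ef by blast
    then obtain a b where ab: "a \<in> A" "b \<notin> A" and f: "h f = a \<and> t f = b \<or> h f = b \<and> t f = a"
      unfolding mem_bd by metis
    have ef': "E \<inter> bd h t (- A) = {e, f}" using ef by (simp add: bd_Compl)
    have ab': "b \<in> - A" "a \<notin> - A" and f': "h f = b \<and> t f = a \<or> h f = a \<and> t f = b" using ab f by auto
    note A = odd_cut_free_collapse[OF G ef ab f] and B = odd_cut_free_collapse[OF G ef' ef(2) ab' f']
    show ?thesis
      by (rule two_edge_cut_case[OF G'(3) ef ab f less.hyps[OF A(2,1)] less.hyps[OF B(2,1)] less.prems(2,3)])
        (use k in auto)
  qed
qed

lemma odd_cut_free_common_circuit:
  assumes G: "odd_cut_free k h t V E" and S: "S \<subseteq> E" "card S \<le> k" "S \<noteq> {}"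
  shows "common_circuit h t E S"
proof (cases "3 \<le> k")
  case True
  then show ?thesis using odd_cut_free_common_circuit_ge_3[OF G S(1,2)] by simp
next
  case False
  have G': "finite E" "h ` E \<union> t ` E \<subseteq> V"
    "\<And>A. A \<inter> V \<noteq> {} \<Longrightarrow> \<not> V \<subseteq> A \<Longrightarrow> E \<inter> bd h t A \<noteq> {}"
    "\<And>A. odd (card (E \<inter> bd h t A)) \<Longrightarrow> k < card (E \<inter> bd h t A)"
    using G by (auto simp: odd_cut_free_def)
  have fS: "finite S" using S G'(1) finite_subset by blast
  have "card S \<noteq> 0" using S(3) fS by simp
  then have "k \<ge> 1" "card S = 1 \<or> card S = 2" using S(2) False by auto
  \<comment> \<open>A single edge is covered by \<open>e = f\<close>.\<close>
  then obtain e f where "S = {e, f}" by (metis card_1_singletonE card_2_iff insert_absorb2)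
  moreover have "card (E \<inter> bd h t A) \<noteq> 1" for A using G'(4)[of A] \<open>k \<ge> 1\<close> by auto
  ultimately show ?thesis using bridgeless_two_edges[OF G'(1) _ G'(3,2)] S(1) by auto
qed

section \<open>Euler circuits\<close>

definition crossing :: "'a set \<Rightarrow> 'a set set" where
  "crossing A = {e. \<exists>u v. e = {u, v} \<and> u \<in> A \<and> v \<notin> A}"

lemma doubleton_crossing: "{x, y} \<in> crossing A \<longleftrightarrow> (x \<in> A) \<noteq> (y \<in> A)"
  unfolding crossing_def by (auto simp: doubleton_eq_iff)

lemma edge_boundary_eq: "edge_boundary E A = E \<inter> crossing A"
  by (auto simp: edge_boundary_def crossing_def)

lemma walk_edges_Cons: "vs \<noteq> [] \<Longrightarrow> walk_edges (x # vs) = {x, hd vs} # walk_edges vs"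
  by (cases vs) auto

lemma walk_edges_join:
  "\<lbrakk>p \<noteq> []; q \<noteq> []; last p = hd q\<rbrakk> \<Longrightarrow> walk_edges (p @ tl q) = walk_edges p @ walk_edges q"
proof (induction p)
  case (Cons x p)
  show ?case
  proof (cases "p = []")
    case True
    then show ?thesis using Cons.prems by (cases q) auto
  next
    case False
    then show ?thesis using Cons by (simp add: walk_edges_Cons)
  qed
qed simp

lemma Union_walk_edges_subset: "\<Union> (set (walk_edges vs)) \<subseteq> set vs"
  by (induction vs rule: walk_edges.induct) auto

lemma distinct_walk_edges: "distinct vs \<Longrightarrow> distinct (walk_edges vs)"
proof (induction vs rule: walk_edges.induct)
  case (1 x y zs)
  then have "{x, y} \<notin> set (walk_edges (y # zs))"
    using Union_walk_edges_subset[of "y # zs"] by auto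
  then show ?case using 1 by auto
qed auto

text \<open>A walk changes sides exactly at its crossing edges; the filtered list counts repeated
  edges with multiplicity.\<close>

lemma parity_walk_crossing:
  "vs \<noteq> [] \<Longrightarrow> odd (length (filter (\<lambda>e. e \<in> crossing A) (walk_edges vs))) \<longleftrightarrow> (hd vs \<in> A) \<noteq> (last vs \<in> A)"
  by (induction vs rule: walk_edges.induct) (auto simp: doubleton_crossing)

lemma parity_trail_crossing:
  assumes "vs \<noteq> []" "distinct (walk_edges vs)"
  shows "odd (card (set (walk_edges vs) \<inter> crossing A)) \<longleftrightarrow> (hd vs \<in> A) \<noteq> (last vs \<in> A)"
proof -
  have "set (walk_edges vs) \<inter> crossing A = set (filter (\<lambda>e. e \<in> crossing A) (walk_edges vs))" by auto
  then have "card (set (walk_edges vs) \<inter> crossing A) = length (filter (\<lambda>e. e \<in> crossing A) (walk_edges vs))"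
    using assms(2) by (simp only: distinct_card distinct_filter)
  then show ?thesis using parity_walk_crossing[OF assms(1)] by simp
qed

text \<open>Refers to edges only, so a single vertex counts wherever it lies; membership in
  \<open>V\<close> is recovered from the edges at the end.\<close>

definition closed_trail :: "'a set set \<Rightarrow> 'a list \<Rightarrow> bool" where
  "closed_trail H vs \<longleftrightarrow> vs \<noteq> [] \<and> hd vs = last vs \<and> distinct (walk_edges vs) \<and> set (walk_edges vs) \<subseteq> H"

text \<open>Split at \<open>x\<close> and exchange the two pieces; \<open>tl\<close> removes the
  doubled start vertex.\<close>

lemma closed_trail_rotate:
  assumes c: "closed_trail H c" and x: "x \<in> set c"
  shows "\<exists>c'. closed_trail H c' \<and> hd c' = x \<and> set (walk_edges c') = set (walk_edges c)"
proof -
  obtain xs ys where xy: "c = xs @ x # ys" using x by (meson split_list)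
  let ?p = "xs @ [x]" and ?q = "x # ys"
  have c1: "walk_edges c = walk_edges ?p @ walk_edges ?q"
    using walk_edges_join[of ?p ?q] xy by simp
  have "last ?q = hd ?p"
    using c xy by (cases xs) (auto simp: closed_trail_def split: if_splits)
  then have c2: "walk_edges (?q @ tl ?p) = walk_edges ?q @ walk_edges ?p"
    by (intro walk_edges_join) auto
  have "last (?q @ tl ?p) = x" using \<open>last ?q = hd ?p\<close> by (cases xs) (auto split: if_splits)
  then have "closed_trail H (?q @ tl ?p)"
    using c unfolding closed_trail_def c1 c2 by auto
  then show ?thesis using c1 c2 by (intro exI[of _ "?q @ tl ?p"]) auto
qed

lemma closed_trail_merge:
  assumes "closed_trail H c" "closed_trail H d" "x \<in> set c" "x \<in> set d"
    and "set (walk_edges c) \<inter> set (walk_edges d) = {}"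
  shows "\<exists>c'. closed_trail H c' \<and> set (walk_edges c') = set (walk_edges c) \<union> set (walk_edges d)"
proof -
  obtain c' where c': "closed_trail H c'" "hd c' = x" "set (walk_edges c') = set (walk_edges c)"
    using closed_trail_rotate[OF assms(1,3)] by auto
  obtain d' where d': "closed_trail H d'" "hd d' = x" "set (walk_edges d') = set (walk_edges d)"
    using closed_trail_rotate[OF assms(2,4)] by auto
  have "walk_edges (c' @ tl d') = walk_edges c' @ walk_edges d'"
    using c' d' by (intro walk_edges_join) (auto simp: closed_trail_def)
  moreover obtain ds where ds: "d' = x # ds" using d' by (cases d') (auto simp: closed_trail_def)
  have "last (c' @ tl d') = x" using c'(1,2) d'(1) by (simp add: ds closed_trail_def last_append)
  moreover have "c' @ tl d' \<noteq> []" "hd (c' @ tl d') = x" using c'(1,2) by (simp_all add: closed_trail_def)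
  ultimately have "closed_trail H (c' @ tl d')"
    using c'(1,3) d'(1,3) assms(5) by (simp add: closed_trail_def)
  then show ?thesis
    using \<open>walk_edges (c' @ tl d') = walk_edges c' @ walk_edges d'\<close> c'(3) d'(3)
    by (intro exI[of _ "c' @ tl d'"]) simp
qed

text \<open>The bridge from cuts to walks: the set of vertices reached by paths from
  \<open>u\<close> is crossed by no edge of \<open>H\<close>, so it contains
  \<open>v\<close>.\<close>

lemma conn_path:
  assumes H: "\<And>x. x \<in> H \<Longrightarrow> x = {h x, t x}" and uv: "conn h t H u v"
  shows "\<exists>vs. vs \<noteq> [] \<and> hd vs = u \<and> last vs = v \<and> distinct vs \<and> set (walk_edges vs) \<subseteq> H"
proof -
  define A where "A = {v. \<exists>vs. vs \<noteq> [] \<and> hd vs = u \<and> last vs = v \<and> distinct vs \<and> set (walk_edges vs) \<subseteq> H}"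
  have step: "q \<in> A" if p: "p \<in> A" and pq: "{p, q} \<in> H" for p q
  proof -
    obtain vs where vs: "vs \<noteq> []" "hd vs = u" "last vs = p" "distinct vs" "set (walk_edges vs) \<subseteq> H"
      using p by (auto simp: A_def)
    show ?thesis
    proof (cases "q \<in> set vs")
      \<comment> \<open>A vertex already on the path is reached by truncating the path
        there.\<close>
      case True
      then obtain xs ys where "vs = xs @ q # ys" by (meson split_list)
      moreover then have "walk_edges vs = walk_edges (xs @ [q]) @ walk_edges (q # ys)"
        using walk_edges_join[of "xs @ [q]" "q # ys"] by simp
      ultimately have "hd (xs @ [q]) = u" "distinct (xs @ [q])" "set (walk_edges (xs @ [q])) \<subseteq> H"
        using vs by (cases xs; auto)+
      then show ?thesis unfolding A_def by (intro CollectI exI[of _ "xs @ [q]"]) auto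
    next
      case False
      have "walk_edges (vs @ [q]) = walk_edges vs @ [{p, q}]"
        using walk_edges_join[of vs "[p, q]"] vs by simp
      then show ?thesis using vs pq False unfolding A_def by (intro CollectI exI[of _ "vs @ [q]"]) auto
    qed
  qed
  have "H \<inter> bd h t A = {}"
  proof (rule ccontr)
    assume "H \<inter> bd h t A \<noteq> {}"
    then obtain x where x: "x \<in> H" "(h x \<in> A) \<noteq> (t x \<in> A)" by (auto simp: bd_def)
    have "{h x, t x} \<in> H" "{t x, h x} \<in> H" using H[OF x(1)] x(1) by (auto simp: insert_commute)
    then show False using step x(2) by blast
  qed
  moreover have "u \<in> A" unfolding A_def by (intro CollectI exI[of _ "[u]"]) auto
  ultimately have "v \<in> A" using uv unfolding conn_def by blast
  then show ?thesis by (simp add: A_def)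
qed

text \<open>An even edge set has no bridge, so a path avoiding \<open>e\<close> connects its ends
  and \<open>e\<close> closes it.\<close>

lemma even_edges_closed_trail:
  assumes D: "\<And>x. x \<in> D \<Longrightarrow> x = {h x, t x}" and even: "even_edges h t D" and e: "e \<in> D"
  shows "\<exists>c. closed_trail D c \<and> e \<in> set (walk_edges c)"
proof -
  have "conn h t (D - {e}) (t e) (h e)"
    unfolding conn_def
  proof (intro allI impI, rule ccontr)
    fix A assume A: "(D - {e}) \<inter> bd h t A = {}" "\<not> (t e \<in> A \<longleftrightarrow> h e \<in> A)"
    from A(2) have "e \<in> bd h t A" unfolding mem_bd by argo
    then have "D \<inter> bd h t A = {e}" using A(1) e by blast
    then have "card (D \<inter> bd h t A) = 1" by simp
    moreover have "even (card (D \<inter> bd h t A))" using even by (simp add: even_edges_def)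
    ultimately show False by simp
  qed
  then obtain vs where vs: "vs \<noteq> []" "hd vs = t e" "last vs = h e" "distinct vs" "set (walk_edges vs) \<subseteq> D - {e}"
    using conn_path[of "D - {e}" h t "t e" "h e"] D by auto
  have "walk_edges (h e # vs) = e # walk_edges vs"
    using vs D[OF e] by (simp add: walk_edges_Cons)
  then show ?thesis using vs e distinct_walk_edges[OF vs(4)]
    by (intro exI[of _ "h e # vs"]) (auto simp: closed_trail_def)
qed

text \<open>A closed trail with the most edges is everything: the remaining edges are even, by
  linkedness one of them touches the trail, and a closed trail through it could be merged.\<close>

lemma euler_circuit:
  assumes fin: "finite H" and H: "\<And>x. x \<in> H \<Longrightarrow> x = {h x, t x}" and ne: "H \<noteq> {}"
    and even: "even_edges h t H" and linked: "linked h t H"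
  shows "\<exists>c. closed_trail H c \<and> set (walk_edges c) = H"
proof -
  have bd: "X \<inter> bd h t A = X \<inter> crossing A" if "X \<subseteq> H" for X A
  proof -
    have "x \<in> bd h t A \<longleftrightarrow> x \<in> crossing A" if "x \<in> H" for x
      using doubleton_crossing[of "h x" "t x" A] H[OF that] by (simp add: mem_bd)
    then show ?thesis using that by blast
  qed
  let ?T = "\<lambda>c. closed_trail H c \<and> set (walk_edges c) \<noteq> {}"
  obtain e where "e \<in> H" using ne by blast
  then obtain c0 where "closed_trail H c0" "e \<in> set (walk_edges c0)"
    using even_edges_closed_trail[OF H even] by auto
  then have c0: "?T c0" by auto
  have bound: "\<forall>c. ?T c \<longrightarrow> card (set (walk_edges c)) < Suc (card H)"
    using fin by (auto simp: closed_trail_def less_Suc_eq_le intro: card_mono)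
  from ex_has_greatest_nat[of ?T, OF c0 bound] obtain c where c: "?T c"
    and max': "\<forall>d. ?T d \<longrightarrow> card (set (walk_edges d)) \<le> card (set (walk_edges c))" by metis
  have max: "card (set (walk_edges d)) \<le> card (set (walk_edges c))" if "?T d" for d
    using max'[rule_format, OF that] .
  let ?C = "set (walk_edges c)"
  have CH: "?C \<subseteq> H" using c by (simp add: closed_trail_def)
  have "?C = H"
  proof (rule ccontr)
    assume neq: "?C \<noteq> H"
    define D where "D = H - ?C"
    have DH: "D \<subseteq> H" and Dne: "D \<noteq> {}" using neq CH by (auto simp: D_def)
    have "even (card (?C \<inter> bd h t A))" for A
      unfolding bd[OF CH] using parity_trail_crossing[of c A] c by (auto simp: closed_trail_def)
    then have "even_edges h t D"
      unfolding even_edges_def D_def using odd_card_Diff[OF fin CH] even[unfolded even_edges_def] by blast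
    have Cin: "h x \<in> set c" "t x \<in> set c" if "x \<in> ?C" for x
    proof -
      have "x \<subseteq> set c" using Union_walk_edges_subset[of c] that by blast
      moreover have "x = {h x, t x}" using that CH H by auto
      ultimately show "h x \<in> set c" "t x \<in> set c" by (metis insert_subset)+
    qed
    \<comment> \<open>Otherwise no edge of \<open>H\<close> crosses \<open>set c\<close>, although
      \<open>H\<close> has edges inside it and edges off it, against linkedness.\<close>
    have "\<exists>x\<in>D. h x \<in> set c \<or> t x \<in> set c"
    proof (rule ccontr)
      assume no: "\<not> ?thesis"
      then have "H \<inter> bd h t (set c) = {}" using Cin by (auto simp: mem_bd D_def)
      then have "h ` H \<subseteq> set c \<or> h ` H \<inter> set c = {}" using linked by (simp add: linked_def)
      moreover obtain y where y: "y \<in> ?C" using c by (metis ex_in_conv)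
      moreover obtain x where x: "x \<in> D" using Dne by (metis ex_in_conv)
      moreover have "h y \<in> h ` H" "h x \<in> h ` H" using x y CH DH by auto
      ultimately show False using no Cin(1)[OF y] by (metis IntI empty_iff subsetD)
    qed
    then obtain x where x: "x \<in> D" "h x \<in> set c \<or> t x \<in> set c" by blast
    obtain d where d: "closed_trail D d" "x \<in> set (walk_edges d)"
      using even_edges_closed_trail[OF H[OF subsetD[OF DH]] \<open>even_edges h t D\<close> x(1)] by auto
    have "x \<subseteq> set d" using Union_walk_edges_subset[of d] d(2) by blast
    moreover have "x = {h x, t x}" using x(1) DH H by auto
    ultimately have "h x \<in> set d" "t x \<in> set d" by (metis insert_subset)+
    then obtain w where w: "w \<in> set c" "w \<in> set d" using x(2) by blast
    have dH: "closed_trail H d" and dis: "?C \<inter> set (walk_edges d) = {}"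
      using d(1) DH by (auto simp: closed_trail_def D_def)
    obtain c' where c': "closed_trail H c'" "set (walk_edges c') = ?C \<union> set (walk_edges d)"
      using closed_trail_merge[OF _ dH w dis] c by blast
    have "set (walk_edges c') \<noteq> {}" using c'(2) d(2) by (metis UnI2 empty_iff)
    then have "card (set (walk_edges c')) \<le> card ?C" using c'(1) by (intro max) blast
    moreover have "card ?C < card (set (walk_edges c'))"
      unfolding c'(2) using d(2) dis by (intro psubset_card_mono) auto
    ultimately show False by simp
  qed
  then show ?thesis using c by blast
qed

section \<open>Transfer to simple graphs\<close>

lemma set_walk_subset:
  assumes "2 \<le> length vs"
  shows "set vs \<subseteq> \<Union> (set (walk_edges vs))"
  using assms
proof (induction vs rule: walk_edges.induct)
  case (1 x y zs)
  then show ?case by (cases zs) auto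
qed auto

theorem theorem1p4:
  fixes k :: nat and V :: "'a set" and E :: "'a set set"
  assumes "k \<ge> 1"
    and "finite_simple_graph V E"
    and "connected_graph V E"
    and "k \<le> card E"
  shows "(\<forall>S. S \<subseteq> E \<and> card S = k \<longrightarrow> (\<exists>vs. circuit V E vs \<and> S \<subseteq> set (walk_edges vs)))
    \<longleftrightarrow> \<not> (\<exists>F. odd_cut V E F \<and> card F \<le> k)"
proof -
  have V: "finite V" "V \<noteq> {}" using assms(2,3) by (auto simp: finite_simple_graph_def connected_graph_def)
  have sub: "e \<subseteq> V" if e: "e \<in> E" for e
  proof -
    obtain u v where "u \<in> V" "v \<in> V" "e = {u, v}" using assms(2) e unfolding finite_simple_graph_def by meson
    then show ?thesis by simp
  qed
  then have E: "finite E" using V(1) by (meson PowI finite_Pow_iff finite_subset subsetI)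
  have "\<forall>e\<in>E. \<exists>p. e = {fst p, snd p}"
  proof
    fix e assume "e \<in> E"
    then obtain u v where "e = {u, v}" using assms(2) unfolding finite_simple_graph_def by meson
    then show "\<exists>p. e = {fst p, snd p}" by (intro exI[of _ "(u, v)"]) simp
  qed
  \<comment> \<open>An arbitrary orientation of each edge turns the simple graph into a multigraph
    whose edges are the sets themselves.\<close>
  then obtain ends where ends: "\<forall>e\<in>E. e = {fst (ends e), snd (ends e)}" by (rule bchoice[THEN exE])
  define h where "h e = fst (ends e)" for e
  define t where "t e = snd (ends e)" for e
  have ht: "e = {h e, t e}" if "e \<in> E" for e using ends that by (simp add: h_def t_def)
  have htV: "h e \<in> V" "t e \<in> V" if "e \<in> E" for e
  proof -
    have "{h e, t e} \<subseteq> V" using ht[OF that] sub[OF that] by metis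
    then show "h e \<in> V" "t e \<in> V" by auto
  qed
  have bd: "E \<inter> bd h t A = E \<inter> crossing A" for A
  proof -
    have "x \<in> bd h t A \<longleftrightarrow> x \<in> crossing A" if "x \<in> E" for x
      using doubleton_crossing[of "h x" "t x" A] ht[OF that] by (simp add: mem_bd)
    then show ?thesis by blast
  qed
  show ?thesis
  proof (intro iffI notI allI impI)
    assume L: "\<forall>S. S \<subseteq> E \<and> card S = k \<longrightarrow> (\<exists>vs. circuit V E vs \<and> S \<subseteq> set (walk_edges vs))"
    assume "\<exists>F. odd_cut V E F \<and> card F \<le> k"
    then obtain A where A: "odd (card (E \<inter> crossing A))" "card (E \<inter> crossing A) \<le> k"
      by (auto simp: odd_cut_def cut_def edge_boundary_eq)
    \<comment> \<open>The odd cut is padded to exactly \<open>k\<close> edges, which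
      \<open>k \<le> card E\<close> permits. A circuit through \<open>S\<close> would then cross the
      cut in an odd number of edges.\<close>
    obtain S where S: "E \<inter> crossing A \<subseteq> S" "S \<subseteq> E" "card S = k"
      using exists_subset_between[OF A(2) assms(4) Int_lower1 E] by metis
    then obtain vs where vs: "circuit V E vs" "S \<subseteq> set (walk_edges vs)" using L by blast
    have "set (walk_edges vs) \<inter> crossing A = E \<inter> crossing A"
      using S(1) vs by (auto simp: circuit_def trail_def walk_def)
    then show False
      using parity_trail_crossing[of vs A] vs(1) A(1) by (auto simp: circuit_def trail_def walk_def)
  next
    assume R: "\<not> (\<exists>F. odd_cut V E F \<and> card F \<le> k)"
    fix S assume "S \<subseteq> E \<and> card S = k"
    then have S: "S \<subseteq> E" "card S \<le> k" "S \<noteq> {}" using assms(1) by auto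
    have "E \<inter> bd h t A \<noteq> {}" if A: "A \<inter> V \<noteq> {}" "\<not> V \<subseteq> A" for A
    proof -
      obtain u v where uv: "u \<in> V" "u \<in> A" "v \<in> V" "v \<notin> A" using A by blast
      then obtain vs where vs: "walk V E vs" "hd vs = u" "last vs = v"
        using assms(3) unfolding connected_graph_def by meson
      have "odd (length (filter (\<lambda>e. e \<in> crossing A) (walk_edges vs)))"
        using parity_walk_crossing[of vs A] vs uv by (simp add: walk_def)
      then have "filter (\<lambda>e. e \<in> crossing A) (walk_edges vs) \<noteq> []" by auto
      then obtain e where "e \<in> set (walk_edges vs)" "e \<in> crossing A" by (auto simp: filter_empty_conv)
      then show ?thesis unfolding bd using vs(1) by (auto simp: walk_def)
    qed
    moreover have "k < card (E \<inter> bd h t A)" if "odd (card (E \<inter> bd h t A))" for A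
    proof -
      \<comment> \<open>Cuts are taken by subsets of \<open>V\<close>, so an arbitrary
        \<open>A\<close> is first intersected with \<open>V\<close>.\<close>
      have "E \<inter> bd h t A = E \<inter> bd h t (A \<inter> V)" using htV by (auto simp: mem_bd)
      then have eq: "E \<inter> bd h t A = edge_boundary E (A \<inter> V)" by (simp add: bd edge_boundary_eq)
      then have "odd_cut V E (E \<inter> bd h t A)" using that unfolding odd_cut_def cut_def by blast
      then show ?thesis using R by (meson not_le)
    qed
    moreover have "h ` E \<union> t ` E \<subseteq> V" using htV by auto
    ultimately have "odd_cut_free k h t V E" using V E by (auto simp: odd_cut_free_def)
    then have "common_circuit h t E S" using S by (rule odd_cut_free_common_circuit)
    then obtain H where H: "H \<subseteq> E" "S \<subseteq> H" "even_edges h t H" "linked h t H"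
      by (auto simp: common_circuit_def)
    have "\<exists>c. closed_trail H c \<and> set (walk_edges c) = H"
      using H S(3) E finite_subset ht by (intro euler_circuit[of H h t]) blast+
    then obtain c where c: "closed_trail H c" "set (walk_edges c) = H" by blast
    \<comment> \<open>With at least one edge, every vertex of \<open>c\<close> is an end of an edge
      and hence lies in \<open>V\<close>.\<close>
    have "walk_edges c \<noteq> []" using c(2) H(2) S(3) by auto
    then have "2 \<le> length c" by (cases c rule: walk_edges.cases) auto
    then have "set c \<subseteq> \<Union> H" using set_walk_subset c(2) by metis
    then have "set c \<subseteq> V" using H(1) sub by blast
    then have "circuit V E c"
      using c H(1) by (auto simp: circuit_def trail_def walk_def closed_trail_def)
    then show "\<exists>vs. circuit V E vs \<and> S \<subseteq> set (walk_edges vs)" using c(2) H(2) by blast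
  qed
qed

end
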